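(* Let $c\geq 1$ be a constant. Let $\mathcal C_c$ be the class of graphs $G$ such that $\mathrm{cr}(H)\leq c\,|H_{\geq 3}|$ for every subgraph $H$ of $G$. Then $\mathcal C_c$ is contained in a proper topologically-closed class of graphs. Precisely, $\widetilde{\nabla}(\mathcal C_c)\leq 4c^{1/3}$.
   Context: All graphs are finite and simple; $|G|$ is the number of vertices and $\|G\|$ the number of edges of $G$. $\mathrm{cr}(G)$ is the crossing number of $G$: the minimum number of crossings in a drawing of $G$ in the plane. $G_{\geq 3}$ denotes the subgraph of $G$ induced by the vertices of $G$ that have degree at least $3$ in $G$. A subdivision of a graph $H$ is a graph obtained by replacing each edge $vw$ of $H$ by a path between $v$ and $w$ (internally disjoint from everything else). $H$ is a topological minor of $G$ if some subdivision of $H$ is isomorphic to a subgraph of $G$. A class is topologically-closed if it contains every topological minor of each of its members, and it is proper if it does not contain all finite simple graphs. $\widetilde{\nabla}(\mathcal C)$ is the supremum of $\|H\|/|H|$ over all (non-empty) topological minors $H$ of graphs in $\mathcal C$. *)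

theory Defs
  imports
    "HOL-Analysis.Analysis"
    "HOL-Library.Infinite_Typeclass"
    "Graph_Theory.Digraph_Isomorphism"
    "Graph_Theory.Subdivision"
begin

text \<open>
  A finite simple graph is a \<^const>\<open>pair_graph\<close>: a finite, loop-free, symmetric set of pairs over
  a finite vertex set. Each undirected edge is a pair of opposite arcs, so edges are counted as
  two-element sets.
\<close>

definition edges :: "'a pair_pre_digraph \<Rightarrow> 'a set set" where
  "edges G = (\<lambda>(u, v). {u, v}) ` parcs G"

definition num_verts :: "'a pair_pre_digraph \<Rightarrow> nat" where
  "num_verts G = card (pverts G)"

definition num_edges :: "'a pair_pre_digraph \<Rightarrow> nat" where
  "num_edges G = card (edges G)"

text \<open>
  \<open>is_subgraph H G\<close> requires \<open>H\<close> itself to be an undirected graph; \<^const>\<open>subgraph\<close> alone would also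
  admit a digraph that keeps only one arc of an opposite pair.
\<close>

definition is_subgraph :: "'a pair_pre_digraph \<Rightarrow> 'a pair_pre_digraph \<Rightarrow> bool" where
  "is_subgraph H G \<longleftrightarrow> pair_graph H \<and> pair_graph G \<and> subgraph (with_proj H) (with_proj G)"

text \<open>In a symmetric digraph the undirected degree of a vertex is its out-degree.\<close>

definition deg_ge3 :: "'a pair_pre_digraph \<Rightarrow> 'a pair_pre_digraph" where
  "deg_ge3 G = (let W = {v \<in> pverts G. 3 \<le> out_degree (with_proj G) v}
     in \<lparr> pverts = W, parcs = arcs (with_proj G \<restriction> W) \<rparr>)"

text \<open>
  A drawing in the plane (\<^typ>\<open>complex\<close>) places the vertices at distinct points and draws every edge
  as a simple arc between its ends that contains no other vertex; no three edges meet in a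
  point that is not a common end. A crossing is a point shared by two edges, other than
  a common end. Tangential contact is not excluded, but it counts as a crossing.
\<close>

definition drawing ::
  "'a pair_pre_digraph \<Rightarrow> ('a \<Rightarrow> complex) \<Rightarrow> ('a set \<Rightarrow> real \<Rightarrow> complex) \<Rightarrow> bool" where
  "drawing G p \<gamma> \<longleftrightarrow>
     inj_on p (pverts G) \<and>
     (\<forall>e\<in>edges G. arc (\<gamma> e) \<and> {pathstart (\<gamma> e), pathfinish (\<gamma> e)} = p ` e) \<and>
     (\<forall>e\<in>edges G. \<forall>v\<in>pverts G. p v \<in> path_image (\<gamma> e) \<longrightarrow> v \<in> e) \<and>
     (\<forall>e\<in>edges G. \<forall>f\<in>edges G. \<forall>g\<in>edges G. e \<noteq> f \<and> e \<noteq> g \<and> f \<noteq> g \<longrightarrow>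
        path_image (\<gamma> e) \<inter> path_image (\<gamma> f) \<inter> path_image (\<gamma> g) \<subseteq> p ` (e \<inter> f \<inter> g))"

definition crossings ::
  "'a pair_pre_digraph \<Rightarrow> ('a \<Rightarrow> complex) \<Rightarrow> ('a set \<Rightarrow> real \<Rightarrow> complex) \<Rightarrow> complex set" where
  "crossings G p \<gamma> =
     {x. \<exists>e\<in>edges G. \<exists>f\<in>edges G. e \<noteq> f \<and>
        x \<in> path_image (\<gamma> e) \<inter> path_image (\<gamma> f) - p ` (e \<inter> f)}"

text \<open>
  The infimum in \<^typ>\<open>enat\<close> of a nonempty set is attained, so this is the minimum; it would be
  infinite if there were no drawing with finitely many crossings.
\<close>

definition crossing_number :: "'a pair_pre_digraph \<Rightarrow> enat" where
  "crossing_number G =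
     Inf {enat (card (crossings G p \<gamma>)) | p \<gamma>. drawing G p \<gamma> \<and> finite (crossings G p \<gamma>)}"

text \<open>
  The sort \<^class>\<open>infinite\<close> provides the fresh vertices that a subdivision of \<open>H\<close> needs.
\<close>

definition topological_minor :: "'a::infinite pair_pre_digraph \<Rightarrow> 'a pair_pre_digraph \<Rightarrow> bool" where
  "topological_minor H G \<longleftrightarrow> pair_graph H \<and> pair_graph G \<and>
     (\<exists>S S'. subdivision_pair H S \<and> digraph_iso (with_proj S) (with_proj S') \<and> is_subgraph S' G)"

text \<open>
  Classes of graphs are sets of graphs on one infinite vertex type, on which every finite
  graph has an isomorphic copy. Since every graph is a topological minor of its isomorphic copies,
  topologically closed classes are closed under isomorphism.
\<close>

definition topologically_closed :: "'a::infinite pair_pre_digraph set \<Rightarrow> bool" where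
  "topologically_closed \<C> \<longleftrightarrow>
     (\<forall>G\<in>\<C>. pair_graph G) \<and> (\<forall>G\<in>\<C>. \<forall>H. topological_minor H G \<longrightarrow> H \<in> \<C>)"

definition proper_class :: "'a::infinite pair_pre_digraph set \<Rightarrow> bool" where
  "proper_class \<C> \<longleftrightarrow> \<not> {G. pair_graph G} \<subseteq> \<C>"

definition nabla_top :: "'a::infinite pair_pre_digraph set \<Rightarrow> ereal" where
  "nabla_top \<C> =
     (SUP H \<in> {H. pverts H \<noteq> {} \<and> (\<exists>G\<in>\<C>. topological_minor H G)}.
        ereal (real (num_edges H) / real (num_verts H)))"

definition crossing_class :: "real \<Rightarrow> 'a pair_pre_digraph set" where
  "crossing_class c =
     {G. pair_graph G \<and>
        (\<forall>H. is_subgraph H G \<longrightarrow>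
           ereal_of_enat (crossing_number H) \<le> ereal (c * real (num_verts (deg_ge3 H))))}"

end

theory Submission
  imports Defs
begin

text \<open>
  The bound compares two estimates of crossings. Let \<open>H\<close> be a topological minor of a graph \<open>G\<close> of the
  class, with \<open>n\<close> vertices and \<open>m\<close> edges. The subdivision of \<open>H\<close> in \<open>G\<close> is a subgraph of \<open>G\<close> in which only
  branch vertices can have degree at least \<open>3\<close>, so it has a drawing with at most \<open>c * n\<close> crossings. Reading
  each subdivided edge as one curve turns this into a drawing of \<open>H\<close> with no more crossings. If
  \<open>m > 4 * c powr (1/3) * n\<close>, then \<open>m \<ge> 4 * n\<close>, and the crossing lemma \<open>k \<ge> m ^ 3 / (64 * n ^ 2)\<close> forces
  more than \<open>c * n\<close> crossings, a contradiction.
  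
  The crossing lemma, with the constant \<open>64\<close>, has to be proved for drawings by arbitrary arcs, and adjacent
  edges may meet as well. The averaging argument needs pairs of edges that span four vertices, so only pairs
  of independent edges may be counted. The proof therefore rests on a stronger form of the linear bound for
  planar graphs: if no two independent edges meet, then \<open>m \<le> 3 * n - 3\<close> for \<open>n \<ge> 1\<close>, however adjacent edges behave
  (\<open>edge_bound_independent_disjoint\<close>). There is no appeal to the Jordan curve theorem or to Euler's formula:
  
  \<^item> Five points cannot be joined pairwise by paths such that paths with disjoint pairs of ends are disjoint
    (\<open>K5_paths_meet\<close>). This is a parity argument with continuous logarithms, a version of the
    van Kampen obstruction of \<open>K5\<close>.
  \<^item> Vertices are allowed to be path connected sets instead of points (\<open>blob_drawing\<close>). Such drawings survive
    the contraction of an edge, so a graph drawn without meeting independent edges has no \<open>K5\<close> minor.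
  \<^item> Mader's argument bounds the number of edges: an edge with at most two common neighbours of its ends is
    contracted; if there is none, a vertex of degree at most \<open>5\<close> has a neighbourhood so dense that a \<open>K5\<close> minor
    appears.
  
  Drawing vertices as sets and edges as path connected sets also makes the passage from the subdivision to \<open>H\<close>
  immediate, since no simple arcs have to be extracted.
  
  For the class of all minors of graphs in the crossing class to be topologically closed, minors must compose.
  Topological minors are therefore replaced by models (\<open>topological_model\<close>), in which every edge is sent to a
  set of edges of small degree that connects the images of its ends. Models compose by taking unions, every
  topological minor has a model, and models satisfy the same density bound; the closed class consists of all graphs that have a model in a graph of the
  crossing class. It is proper because complete graphs are arbitrarily dense.
\<close>

section \<open>Five points in the plane joined by paths\<close>

text \<open>
  Two continuous logarithms of the same function, up to a constant factor, differ by a continuous function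
  with values in a discrete set.
\<close>

lemma log_increment_unique:
  fixes h h' :: "real \<Rightarrow> complex"
  assumes "continuous_on {0..1} h" "continuous_on {0..1} h'"
    and eq: "\<And>t. t \<in> {0..1} \<Longrightarrow> exp (h t) = c * exp (h' t)"
  shows "h 1 - h 0 = h' 1 - h' 0"
proof -
  have const: "(\<lambda>t. h t - h' t) constant_on {0..1}"
  proof (rule continuous_discrete_range_constant)
    show "Topological_Spaces.connected {0..1::real}" by simp
    show "continuous_on {0..1} (\<lambda>t. h t - h' t)" using assms by (intro continuous_intros)
    fix x :: real assume x: "x \<in> {0..1}"
    show "\<exists>e>0. \<forall>y. y \<in> {0..1} \<and> h y - h' y \<noteq> h x - h' x \<longrightarrow> e \<le> norm (h y - h' y - (h x - h' x))"
    proof (intro exI[of _ "2*pi"] conjI allI impI)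
      fix y assume y: "y \<in> {0..1} \<and> h y - h' y \<noteq> h x - h' x"
      have "exp (h y - h' y) = exp (h x - h' x)"
        using eq[of x] eq[of y] x y by (simp add: exp_diff)
      then obtain n :: int where n: "h y - h' y = h x - h' x + (of_int (2 * n) * pi) * \<i>"
        unfolding exp_eq by blast
      with y have "n \<noteq> 0" by auto
      then have "1 \<le> \<bar>real_of_int n\<bar>" by linarith
      then have "2 * pi * 1 \<le> 2 * pi * \<bar>real_of_int n\<bar>" by (intro mult_left_mono) auto
      moreover have "norm (h y - h' y - (h x - h' x)) = 2 * pi * \<bar>real_of_int n\<bar>"
        unfolding n by (simp add: norm_mult)
      ultimately show "2*pi \<le> norm (h y - h' y - (h x - h' x))" by simp
    qed simp
  qed
  then have "h 1 - h' 1 = h 0 - h' 0" unfolding constant_on_def by force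
  then show ?thesis by (simp add: algebra_simps)
qed

text \<open>
  As \<open>g\<close> and \<open>g'\<close> are disjoint, \<open>g s - g' t\<close> has a continuous logarithm on the unit square. The four
  increments in the conclusion are its increments along the four sides, and these cancel.
\<close>

lemma log_increments_disjoint_paths:
  fixes g g' :: "real \<Rightarrow> complex"
  assumes "path g" "path g'" and disj: "path_image g \<inter> path_image g' = {}"
    and cont: "continuous_on {0..1} a" "continuous_on {0..1} b"
      "continuous_on {0..1} c" "continuous_on {0..1} d"
    and a: "\<And>t. t \<in> {0..1} \<Longrightarrow> exp (a t) = g t - pathstart g'"
    and b: "\<And>t. t \<in> {0..1} \<Longrightarrow> exp (b t) = g t - pathfinish g'"
    and c: "\<And>t. t \<in> {0..1} \<Longrightarrow> exp (c t) = g' t - pathfinish g"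
    and d: "\<And>t. t \<in> {0..1} \<Longrightarrow> exp (d t) = g' t - pathstart g"
  shows "(a 1 - a 0) - (b 1 - b 0) + (c 1 - c 0) - (d 1 - d 0) = 0"
proof -
  define F where "F = (\<lambda>z. g (fst z) - g' (snd z))"
  let ?S = "{0..1::real} \<times> {0..1::real}"
  have "continuous_on ?S F" unfolding F_def
    using assms(1,2) unfolding path_def
    by (intro continuous_on_diff continuous_on_compose2[of "{0..1}" g _ fst]
        continuous_on_compose2[of "{0..1}" g' _ snd] continuous_on_fst continuous_on_snd continuous_on_id) auto
  moreover have "contractible ?S" by (intro convex_imp_contractible convex_Times) auto
  moreover have "\<And>z. z \<in> ?S \<Longrightarrow> F z \<noteq> 0"
    using disj unfolding F_def path_image_def by (auto simp: disjoint_iff)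
  ultimately obtain H where H: "continuous_on ?S H" "\<And>z. z \<in> ?S \<Longrightarrow> F z = exp (H z)"
    using continuous_logarithm_on_contractible by metis
  have slice1: "continuous_on {0..1} (\<lambda>s. H (s, t))" if "t \<in> {0..1}" for t
    using that by (intro continuous_on_compose2[OF H(1)] continuous_intros) auto
  have slice2: "continuous_on {0..1} (\<lambda>t. H (s, t))" if "s \<in> {0..1}" for s
    using that by (intro continuous_on_compose2[OF H(1)] continuous_intros) auto
  have "a 1 - a 0 = H (1,0) - H (0,0)"
    by (rule log_increment_unique[OF cont(1) slice1, where c=1])
      (use a H(2) in \<open>auto simp: F_def pathstart_def simp flip: H(2)\<close>)
  moreover have "b 1 - b 0 = H (1,1) - H (0,1)"
    by (rule log_increment_unique[OF cont(2) slice1, where c=1])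
      (use b H(2) in \<open>auto simp: F_def pathfinish_def simp flip: H(2)\<close>)
  moreover have "c 1 - c 0 = H (1,1) - H (1,0)"
    by (rule log_increment_unique[OF cont(3) slice2, where c="-1"])
      (use c H(2) in \<open>auto simp: F_def pathfinish_def simp flip: H(2)\<close>)
  moreover have "d 1 - d 0 = H (0,1) - H (0,0)"
    by (rule log_increment_unique[OF cont(4) slice2, where c="-1"])
      (use d H(2) in \<open>auto simp: F_def pathstart_def simp flip: H(2)\<close>)
  ultimately show ?thesis by simp
qed

text \<open>
  Let \<open>n i j k\<close> be the number of turns of \<open>g i j\<close> around \<open>p k\<close>, relative to fixed logarithms \<open>\<theta>\<close> of
  \<open>p i - p k\<close> and \<open>p j - p k\<close>. The preceding lemma gives, for each of the fifteen pairs of disjoint index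
  pairs, a linear relation between these integers. Its constant term comes from the half turn between \<open>z\<close>
  and \<open>- z\<close>; once the relation is divided by \<open>2\<close>, it is odd exactly when the two pairs interleave in the order
  of the indices. Five of the fifteen pairs do, an odd number (these are the crossings of a convex drawing of
  \<open>K5\<close>), whereas each turning number enters two relations and has even total coefficient.
\<close>

theorem K5_paths_meet:
  fixes p :: "nat \<Rightarrow> complex" and g :: "nat \<Rightarrow> nat \<Rightarrow> real \<Rightarrow> complex"
  assumes path: "\<And>i j. i < j \<Longrightarrow> j < 5 \<Longrightarrow> path (g i j) \<and> pathstart (g i j) = p i \<and> pathfinish (g i j) = p j"
    and disj: "\<And>i j k l. i < j \<Longrightarrow> j < 5 \<Longrightarrow> k < l \<Longrightarrow> l < 5 \<Longrightarrow> {i, j} \<inter> {k, l} = {} \<Longrightarrow>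
      path_image (g i j) \<inter> path_image (g k l) = {}"
  shows False
proof -
  \<comment> \<open>Every point lies on a path that avoids any two other indices; this keeps the points off the paths
    and apart from each other.\<close>
  have end_in: "\<exists>k l. k < l \<and> l < 5 \<and> x \<in> {k, l} \<and> y \<notin> {k, l} \<and> z \<notin> {k,l} \<and> p x \<in> path_image (g k l)"
    if "x < 5" "y < 5" "z < 5" "x \<noteq> y" "x \<noteq> z" for x y z
  proof -
    have "card {x, y, z} < card {0..<5::nat}"
      using card_insert_le_m1[of 3 "{y, z}" x] card_insert_le_m1[of 2 "{z}" y] by simp
    then have "\<not> {0..<5} \<subseteq> {x, y, z}"
      by (metis card_mono finite.emptyI finite.insertI linorder_not_le)
    then obtain w where w: "w < 5" "w \<noteq> x" "w \<noteq> y" "w \<noteq> z" by (force simp: subset_iff)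
    show ?thesis
    proof (cases "x < w")
      case True
      then show ?thesis using path[of x w] w that pathstart_in_path_image[of "g x w"] by (intro exI[of _ x] exI[of _ w]) auto
    next
      case False
      then show ?thesis using path[of w x] w that pathfinish_in_path_image[of "g w x"] by (intro exI[of _ w] exI[of _ x]) auto
    qed
  qed
  have avoid: "p k \<notin> path_image (g i j)" if "i < j" "j < 5" "k < 5" "k \<noteq> i" "k \<noteq> j" for i j k
  proof -
    have "i < 5" using that by simp
    then obtain a b where "a < b" "b < 5" "i \<notin> {a,b}" "j \<notin> {a,b}" "p k \<in> path_image (g a b)"
      using end_in[of k i j] \<open>j < 5\<close> \<open>k < 5\<close> \<open>k \<noteq> i\<close> \<open>k \<noteq> j\<close> by auto
    then show ?thesis using disj[of i j a b] that by auto
  qed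
  have p_inj: "p i \<noteq> p j" if "i \<noteq> j" "i < 5" "j < 5" for i j
  proof -
    obtain a b where ab: "a < b" "b < 5" "j \<in> {a, b}" "i \<notin> {a,b}" "p j \<in> path_image (g a b)"
      using end_in[of j i i] \<open>i \<noteq> j\<close> \<open>i < 5\<close> \<open>j < 5\<close> by auto
    then show ?thesis using avoid[of a b i] that by auto
  qed
  have "\<exists>h. continuous_on {0..1} h \<and> (\<forall>t\<in>{0..1}. exp (h t) = g i j t - p k)"
    if ij: "i < j" "j < 5" "k < 5" "k \<noteq> i" "k \<noteq> j" for i j k
  proof -
    have "continuous_on {0..1} (\<lambda>t. g i j t - p k)"
      using path[of i j] ij unfolding path_def by (intro continuous_intros) auto
    moreover have "contractible {0..1::real}" by (intro convex_imp_contractible) auto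
    moreover have "g i j t - p k \<noteq> 0" if "t \<in> {0..1}" for t
    proof -
      have "g i j t \<in> path_image (g i j)" using that by (simp add: path_image_def)
      then show ?thesis using avoid[OF ij] by auto
    qed
    ultimately obtain h where "continuous_on {0..1} h" "\<And>t. t \<in> {0..1} \<Longrightarrow> g i j t - p k = exp (h t)"
      using continuous_logarithm_on_contractible[of "{0..1}" "\<lambda>t. g i j t - p k"] by blast
    then show ?thesis by force
  qed
  then obtain h where h_cont: "\<And>i j k. i < j \<Longrightarrow> j < 5 \<Longrightarrow> k < 5 \<Longrightarrow> k \<noteq> i \<Longrightarrow> k \<noteq> j \<Longrightarrow> continuous_on {0..1} (h i j k)"
    and h: "\<And>i j k t. i < j \<Longrightarrow> j < 5 \<Longrightarrow> k < 5 \<Longrightarrow> k \<noteq> i \<Longrightarrow> k \<noteq> j \<Longrightarrow> t \<in> {0..1} \<Longrightarrow> exp (h i j k t) = g i j t - p k"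
    by metis
  \<comment> \<open>The principal value is used in one direction only; the other direction is shifted by half a turn, so that
    \<open>\<theta> j i - \<theta> i j\<close> is known exactly.\<close>
  define \<theta> where "\<theta> i j = (if i < j then Ln (p j - p i) else Ln (p i - p j) + \<i> * pi)" for i j
  have \<theta>: "exp (\<theta> i j) = p j - p i" if "i \<noteq> j" "i < 5" "j < 5" for i j
    using p_inj[OF that] by (auto simp: \<theta>_def exp_add)
  define \<sigma> where "\<sigma> i j = (if i < j then 1 else -1 :: int)" for i j :: nat
  have \<theta>_swap: "\<theta> j i = \<theta> i j + \<i> * pi * of_int (\<sigma> i j)" if "i \<noteq> j" for i j
    using that by (auto simp: \<theta>_def \<sigma>_def)
  have "\<exists>n::int. h i j k 1 - h i j k 0 = \<theta> k j - \<theta> k i + 2 * \<i> * pi * of_int n"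
    if "i < j" "j < 5" "k < 5" "k \<noteq> i" "k \<noteq> j" for i j k
  proof -
    have "exp (h i j k 1 - h i j k 0) = exp (\<theta> k j - \<theta> k i)"
      using that path[of i j] by (auto simp: exp_diff h \<theta> pathstart_def pathfinish_def)
    then show ?thesis unfolding exp_eq by (force simp: algebra_simps)
  qed
  then obtain n :: "nat \<Rightarrow> nat \<Rightarrow> nat \<Rightarrow> int" where
    n: "\<And>i j k. i < j \<Longrightarrow> j < 5 \<Longrightarrow> k < 5 \<Longrightarrow> k \<noteq> i \<Longrightarrow> k \<noteq> j \<Longrightarrow>
      h i j k 1 - h i j k 0 = \<theta> k j - \<theta> k i + 2 * \<i> * pi * of_int (n i j k)"
    by metis
  define R where "R i j k l = 2 * (n i j k - n i j l + n k l j - n k l i) + (\<sigma> j k - \<sigma> i k - \<sigma> j l + \<sigma> i l)" for i j k l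
  have rel: "R i j k l = 0"
    if "i < j" "j < 5" "k < l" "l < 5" "i \<noteq> k" "i \<noteq> l" "j \<noteq> k" "j \<noteq> l" for i j k l
  proof -
    have "(h i j k 1 - h i j k 0) - (h i j l 1 - h i j l 0) + (h k l j 1 - h k l j 0) - (h k l i 1 - h k l i 0) = 0"
      by (rule log_increments_disjoint_paths[of "g i j" "g k l"])
        (use that path[of i j] path[of k l] disj[of i j k l] in \<open>auto intro!: h_cont simp: h\<close>)
    moreover have "(h i j k 1 - h i j k 0) - (h i j l 1 - h i j l 0) + (h k l j 1 - h k l j 0) - (h k l i 1 - h k l i 0)
      = \<i> * pi * of_int (R i j k l)"
    proof -
      have swaps: "\<theta> k j = \<theta> j k + \<i> * pi * of_int (\<sigma> j k)" "\<theta> k i = \<theta> i k + \<i> * pi * of_int (\<sigma> i k)"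
        "\<theta> l j = \<theta> j l + \<i> * pi * of_int (\<sigma> j l)" "\<theta> l i = \<theta> i l + \<i> * pi * of_int (\<sigma> i l)"
        using that by (auto intro: \<theta>_swap)
      have incs: "h i j k 1 - h i j k 0 = \<theta> k j - \<theta> k i + 2 * \<i> * pi * of_int (n i j k)"
        "h i j l 1 - h i j l 0 = \<theta> l j - \<theta> l i + 2 * \<i> * pi * of_int (n i j l)"
        "h k l j 1 - h k l j 0 = \<theta> j l - \<theta> j k + 2 * \<i> * pi * of_int (n k l j)"
        "h k l i 1 - h k l i 0 = \<theta> i l - \<theta> i k + 2 * \<i> * pi * of_int (n k l i)"
        using that by (auto intro!: n)
      show ?thesis unfolding incs swaps R_def by (simp add: algebra_simps)
    qed
    ultimately have "\<i> * pi * of_int (R i j k l) = 0"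
      by metis
    then have "of_int (R i j k l) = (0::complex)"
      by (metis complex_i_not_zero mult_eq_0_iff of_real_eq_0_iff pi_neq_zero)
    then show ?thesis by (metis of_int_eq_0_iff)
  qed
  \<comment> \<open>Each \<open>n i j k\<close> occurs in two of the relations, with coefficients \<open>2\<close> and \<open>-2\<close>, which cancel, or with
    equal ones; this makes the factor \<open>4\<close>.\<close>
  have "0 = R 0 1 2 3 + R 0 2 1 3 + R 0 3 1 2 + R 0 1 2 4 + R 0 2 1 4
      + R 0 4 1 2 + R 0 1 3 4 + R 0 3 1 4 + R 0 4 1 3 + R 0 2 3 4
      + R 0 3 2 4 + R 0 4 2 3 + R 1 2 3 4 + R 1 3 2 4 + R 1 4 2 3"
    by (simp add: rel)
  also have "\<dots> = 4 * ((n 0 1 2 + n 0 2 1 + n 0 3 1 + n 0 4 1 + n 1 2 3 + n 1 3 2 + n 1 4 2 + n 2 3 4 + n 2 4 3 + n 3 4 2)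
      - (n 0 1 4 + n 0 2 4 + n 0 3 4 + n 0 4 3 + n 1 2 0 + n 1 3 0 + n 1 4 0 + n 2 3 0 + n 2 4 0 + n 3 4 0)) - 10"
    by (simp add: R_def \<sigma>_def)
  finally show False by presburger
qed

section \<open>Drawings with connected sets as vertices, and contraction\<close>

definition simple_graph :: "'v set \<Rightarrow> 'v set set \<Rightarrow> bool" where
  "simple_graph V E \<longleftrightarrow> finite V \<and> (\<forall>e\<in>E. e \<subseteq> V \<and> card e = 2)"

text \<open>
  Vertices are blobs \<open>T v\<close> and edges are connected sets \<open>A e\<close> that touch the blobs of their ends. Nothing is
  required of \<open>A e\<close> near these two blobs or near edges that share an end with \<open>e\<close>: this freedom is what allows
  contraction to merge two blobs and an edge into one blob without any redrawing.
\<close>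

definition blob_drawing ::
  "'v set \<Rightarrow> 'v set set \<Rightarrow> ('v \<Rightarrow> complex set) \<Rightarrow> ('v set \<Rightarrow> complex set) \<Rightarrow> bool" where
  "blob_drawing V E T A \<longleftrightarrow>
     (\<forall>v\<in>V. path_connected (T v) \<and> T v \<noteq> {}) \<and>
     (\<forall>u\<in>V. \<forall>v\<in>V. u \<noteq> v \<longrightarrow> T u \<inter> T v = {}) \<and>
     (\<forall>e\<in>E. path_connected (A e) \<and> (\<forall>v\<in>e. A e \<inter> T v \<noteq> {}) \<and> (\<forall>v\<in>V - e. A e \<inter> T v = {}))"

definition independent_disjoint :: "'v set set \<Rightarrow> ('v set \<Rightarrow> complex set) \<Rightarrow> bool" where
  "independent_disjoint E A \<longleftrightarrow> (\<forall>e\<in>E. \<forall>f\<in>E. e \<inter> f = {} \<longrightarrow> A e \<inter> A f = {})"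

lemma simple_graph_finite_edges: "simple_graph V E \<Longrightarrow> finite E"
  unfolding simple_graph_def by (rule finite_subset[of _ "Pow V"]) auto

lemma simple_graph_edgeD:
  assumes "simple_graph V E" "{u, v} \<in> E"
  shows "u \<in> V" "v \<in> V" "u \<noteq> v"
proof -
  have *: "{u, v} \<subseteq> V" "card {u, v} = 2" using assms unfolding simple_graph_def by blast+
  then show "u \<in> V" "v \<in> V" by blast+
  show "u \<noteq> v" using *(2) by (cases "u = v") auto
qed

lemma simple_graph_edgeE:
  assumes "simple_graph V E" "e \<in> E" "v \<in> e"
  obtains w where "e = {v, w}" "w \<noteq> v"
proof -
  have "card e = 2" using assms unfolding simple_graph_def by blast
  then obtain x y where "e = {x, y}" "x \<noteq> y" unfolding card_2_iff by blast
  then show thesis using assms(3) that[of x] that[of y] by blast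
qed

lemma simple_graph_mono:
  "simple_graph V E \<Longrightarrow> E' \<subseteq> E \<Longrightarrow> simple_graph V E'"
  unfolding simple_graph_def by blast

lemma blob_drawing_mono:
  "blob_drawing V E T A \<Longrightarrow> V' \<subseteq> V \<Longrightarrow> E' \<subseteq> E \<Longrightarrow> blob_drawing V' E' T A"
  unfolding blob_drawing_def subset_eq by (elim conjE, intro conjI ballI impI) auto

lemma independent_disjoint_mono:
  "independent_disjoint E A \<Longrightarrow> E' \<subseteq> E \<Longrightarrow> independent_disjoint E' A"
  unfolding independent_disjoint_def by blast

lemma path_connected_edge_blob:
  assumes "blob_drawing V E T A" "{u, v} \<in> E" "u \<in> V" "v \<in> V"
  shows "path_connected (T u \<union> A {u, v} \<union> T v)"
proof -
  have "path_connected (T u)" "path_connected (A {u, v})" "path_connected (T v)"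
    "A {u, v} \<inter> T u \<noteq> {}" "A {u, v} \<inter> T v \<noteq> {}"
    using assms unfolding blob_drawing_def by auto
  then show ?thesis by (intro path_connected_Un) blast+
qed

text \<open>
  Choosing one point in each blob and a path through the blobs and the edge between any two of them leads
  back to five points and ten paths.
\<close>

lemma no_K5_blob_drawing:
  assumes blob: "blob_drawing V E T A" and indep: "independent_disjoint E A"
    and S: "S \<subseteq> V" "card S = 5" and complete: "\<And>u v. u \<in> S \<Longrightarrow> v \<in> S \<Longrightarrow> u \<noteq> v \<Longrightarrow> {u, v} \<in> E"
  shows False
proof -
  obtain f where f: "bij_betw f {0..<5::nat} S"
    using S by (metis card.infinite ex_bij_betw_nat_finite zero_neq_numeral)
  have fS: "f i \<in> S" if "i < 5" for i using f that by (auto simp: bij_betw_def)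
  have f_inj: "f i \<noteq> f j" if "i \<noteq> j" "i < 5" "j < 5" for i j
    using f that by (auto simp: bij_betw_def inj_on_def)
  define p where "p i = (SOME z. z \<in> T (f i))" for i
  have p: "p i \<in> T (f i)" if "i < 5" for i
    using blob S fS[OF that] unfolding blob_drawing_def p_def by (metis some_in_eq subsetD)
  define U where "U i j = T (f i) \<union> A {f i, f j} \<union> T (f j)" for i j
  have "\<exists>g. path g \<and> path_image g \<subseteq> U i j \<and> pathstart g = p i \<and> pathfinish g = p j"
    if "i < j" "j < 5" for i j
  proof -
    have i5: "i < 5" using that by simp
    have e: "{f i, f j} \<in> E" using complete[OF fS[OF i5] fS[OF that(2)]] f_inj[of i j] that i5 by auto
    have V: "f i \<in> V" "f j \<in> V" using fS i5 that S by auto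
    have "path_connected (U i j)" unfolding U_def
      by (rule path_connected_edge_blob[OF blob e V])
    then show ?thesis unfolding path_connected_def using p[OF i5] p[OF that(2)] by (auto simp: U_def)
  qed
  then obtain g where g: "\<And>i j. i < j \<Longrightarrow> j < 5 \<Longrightarrow> path (g i j) \<and> path_image (g i j) \<subseteq> U i j
      \<and> pathstart (g i j) = p i \<and> pathfinish (g i j) = p j" by metis
  have U_disj: "U i j \<inter> U k l = {}"
    if "i < j" "j < 5" "k < l" "l < 5" "{i, j} \<inter> {k, l} = {}" for i j k l
  proof -
    have lt: "i < 5" "k < 5" using that by auto
    have ne: "f i \<noteq> f j" "f k \<noteq> f l" "f i \<noteq> f k" "f i \<noteq> f l" "f j \<noteq> f k" "f j \<noteq> f l"
      using that lt f_inj by auto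
    have inV: "f i \<in> V" "f j \<in> V" "f k \<in> V" "f l \<in> V" using fS S lt that by auto
    have e: "{f i, f j} \<in> E" "{f k, f l} \<in> E" using complete fS ne lt that by auto
    have "A {f i, f j} \<inter> A {f k, f l} = {}"
      using indep e ne unfolding independent_disjoint_def by auto
    moreover have "T (f i) \<inter> T (f k) = {}" "T (f i) \<inter> T (f l) = {}" "T (f j) \<inter> T (f k) = {}" "T (f j) \<inter> T (f l) = {}"
      using blob inV ne unfolding blob_drawing_def by auto
    moreover have "A {f i, f j} \<inter> T (f k) = {}" "A {f i, f j} \<inter> T (f l) = {}"
       "A {f k, f l} \<inter> T (f i) = {}" "A {f k, f l} \<inter> T (f j) = {}"
      using blob inV ne e unfolding blob_drawing_def by auto
    ultimately show ?thesis unfolding U_def by blast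
  qed
  show False
  proof (rule K5_paths_meet[of g p])
    fix i j :: nat assume "i < j" "j < 5"
    then show "path (g i j) \<and> pathstart (g i j) = p i \<and> pathfinish (g i j) = p j" using g by blast
  next
    fix i j k l :: nat assume *: "i < j" "j < 5" "k < l" "l < 5" "{i, j} \<inter> {k, l} = {}"
    show "path_image (g i j) \<inter> path_image (g k l) = {}"
      using U_disj[OF *] g[OF *(1,2)] g[OF *(3,4)] by blast
  qed
qed

text \<open>
  The edge \<open>{u, v}\<close> is contracted into \<open>u\<close>.
\<close>

definition contract :: "'v \<Rightarrow> 'v \<Rightarrow> 'v set set \<Rightarrow> 'v set set" where
  "contract u v E = {e \<in> E. v \<notin> e} \<union> (\<lambda>e. insert u (e - {v})) ` {e \<in> E. v \<in> e \<and> u \<notin> e}"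

text \<open>
  Each edge of the contracted graph inherits the drawing of one edge of the original graph. Of two
  edges that become parallel, the one at \<open>u\<close> is kept.
\<close>

definition contract_origin :: "'v \<Rightarrow> 'v \<Rightarrow> 'v set set \<Rightarrow> 'v set \<Rightarrow> 'v set" where
  "contract_origin u v E e = (if e \<in> E then e else insert v (e - {u}))"

lemma contract_cases:
  assumes "simple_graph V E" "e \<in> contract u v E"
  obtains "e \<in> E" "v \<notin> e" "contract_origin u v E e = e"
  | x where "e = {u, x}" "{v, x} \<in> E" "x \<noteq> u" "x \<noteq> v" "u \<noteq> v" "contract_origin u v E e = {v, x}"
proof (cases "e \<in> E \<and> v \<notin> e")
  case True
  then show ?thesis using that(1) by (auto simp: contract_origin_def)
next
  case False
  then obtain d where d: "d \<in> E" "v \<in> d" "u \<notin> d" "e = insert u (d - {v})"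
    using assms(2) by (auto simp: contract_def)
  then obtain x where x: "d = {v, x}" "x \<noteq> v" using simple_graph_edgeE[OF assms(1)] by metis
  then have "e = {u, x}" using d by auto
  moreover have "e \<notin> E" using False d by auto
  ultimately show ?thesis using that(2)[of x] d x by (auto simp: contract_origin_def)
qed

lemma contract_origin_in:
  assumes "simple_graph V E" "e \<in> contract u v E"
  shows "contract_origin u v E e \<in> E"
  using assms
proof (cases rule: contract_cases)
  case 1
  then show ?thesis by metis
next
  case (2 x)
  then show ?thesis by metis
qed

lemma simple_graph_contract:
  assumes "simple_graph V E" "{u, v} \<in> E"
  shows "simple_graph (V - {v}) (contract u v E)"
proof -
  have "e \<subseteq> V - {v} \<and> card e = 2" if "e \<in> contract u v E" for e
    using contract_cases[OF assms(1) that]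
  proof cases
    case 1
    then show ?thesis using assms(1) by (auto simp: simple_graph_def)
  next
    case (2 x)
    then show ?thesis using simple_graph_edgeD[OF assms] simple_graph_edgeD[OF assms(1) 2(2)] by auto
  qed
  then show ?thesis using assms(1) by (auto simp: simple_graph_def)
qed

text \<open>
  Contraction loses the contracted edge and one edge for each triangle on it.
\<close>

lemma card_contract:
  assumes G: "simple_graph V E" and uv: "{u, v} \<in> E"
  shows "card E \<le> card (contract u v E) + 1 + card {x. {u, x} \<in> E \<and> {v, x} \<in> E}"
proof -
  let ?C = "{x. {u, x} \<in> E \<and> {v, x} \<in> E}"
  have finC: "finite ?C"
  proof (rule finite_subset)
    show "?C \<subseteq> V" using simple_graph_edgeD(2)[OF G] by blast
    show "finite V" using G by (simp add: simple_graph_def)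
  qed
  have finE': "finite (contract u v E)"
    using simple_graph_finite_edges[OF simple_graph_contract[OF assms]] .
  have "E \<subseteq> contract_origin u v E ` contract u v E \<union> {{u, v}} \<union> (\<lambda>x. {v, x}) ` ?C"
  proof
    fix e assume e: "e \<in> E"
    show "e \<in> contract_origin u v E ` contract u v E \<union> {{u, v}} \<union> (\<lambda>x. {v, x}) ` ?C"
    proof (cases "v \<in> e")
      case False
      then have "contract_origin u v E e = e" "e \<in> contract u v E"
        using e by (auto simp: contract_origin_def contract_def)
      then show ?thesis by (intro UnI1 image_eqI[of _ _ e]) simp_all
    next
      case True
      then obtain x where x: "e = {v, x}" "x \<noteq> v" using simple_graph_edgeE[OF G e] by metis
      consider "x = u" | "x \<noteq> u" "{u, x} \<in> E" | "x \<noteq> u" "{u, x} \<notin> E" by blast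
      then show ?thesis
      proof cases
        case 1
        then show ?thesis using x by auto
      next
        case 2
        then show ?thesis using x e by auto
      next
        case 3
        have "insert u (e - {v}) = {u, x}" using x by auto
        then have "{u, x} \<in> contract u v E"
          using e x 3 simple_graph_edgeD(3)[OF assms] unfolding contract_def
          by (intro UnI2 image_eqI[of _ _ e]) auto
        moreover have "contract_origin u v E {u, x} = e" using 3 x by (auto simp: contract_origin_def)
        ultimately show ?thesis by (intro UnI1 image_eqI[of _ _ "{u, x}"]) simp_all
      qed
    qed
  qed
  then have "card E \<le> card (contract_origin u v E ` contract u v E \<union> {{u, v}} \<union> (\<lambda>x. {v, x}) ` ?C)"
    using finC finE' by (intro card_mono) auto
  also have "\<dots> \<le> card (contract_origin u v E ` contract u v E) + card {{u, v}} + card ((\<lambda>x. {v, x}) ` ?C)"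
    by (meson add_le_mono1 card_Un_le order_trans)
  also have "\<dots> \<le> card (contract u v E) + 1 + card ?C"
    using card_image_le[OF finC] card_image_le[OF finE'] by (intro add_mono) auto
  finally show ?thesis .
qed

text \<open>
  The new blob of \<open>u\<close> is the union of both blobs and the contracted edge. An edge that avoids \<open>u\<close> and \<open>v\<close> is
  independent of \<open>{u, v}\<close>, so it stays away from that union. Independent edges have independent origins.
\<close>

lemma blob_drawing_contract:
  assumes G: "simple_graph V E" and blob: "blob_drawing V E T A" and indep: "independent_disjoint E A"
    and uv: "{u, v} \<in> E"
  defines "T' \<equiv> T(u := T u \<union> A {u, v} \<union> T v)" and "A' \<equiv> \<lambda>e. A (contract_origin u v E e)"
  shows "blob_drawing (V - {v}) (contract u v E) T' A'" "independent_disjoint (contract u v E) A'"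
proof -
  note inV = simple_graph_edgeD[OF G uv]
  have pc: "path_connected (T u \<union> A {u, v} \<union> T v)"
    by (rule path_connected_edge_blob[OF blob uv inV(1,2)])
  have T_disj: "T x \<inter> T y = {}" if "x \<in> V" "y \<in> V" "x \<noteq> y" for x y
    using blob that unfolding blob_drawing_def by blast
  have A_T: "A e \<inter> T x = {}" if "e \<in> E" "x \<in> V" "x \<notin> e" for e x
    using blob that unfolding blob_drawing_def by blast
  have A_meets: "A e \<inter> T x \<noteq> {}" if "e \<in> E" "x \<in> e" for e x
    using blob that unfolding blob_drawing_def by blast
  have A_A: "A e \<inter> A f = {}" if "e \<in> E" "f \<in> E" "e \<inter> f = {}" for e f
    using indep that unfolding independent_disjoint_def by blast
  have "path_connected (A' e) \<and> (\<forall>x\<in>e. A' e \<inter> T' x \<noteq> {}) \<and> (\<forall>x\<in>V - {v} - e. A' e \<inter> T' x = {})"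
    if e: "e \<in> contract u v E" for e
  proof -
    have "path_connected (A' e)"
      using blob contract_origin_in[OF G e] unfolding blob_drawing_def A'_def by blast
    moreover from contract_cases[OF G e]
    have "(\<forall>x\<in>e. A' e \<inter> T' x \<noteq> {}) \<and> (\<forall>x\<in>V - {v} - e. A' e \<inter> T' x = {})"
    proof cases
      case 1
      have "A e \<inter> T' x \<noteq> {}" if "x \<in> e" for x
        using A_meets[OF 1(1) that] by (auto simp: T'_def)
      moreover have "A e \<inter> T' x = {}" if "x \<in> V - {v} - e" for x
        using that A_T[OF 1(1), of x] A_T[OF 1(1), of v] A_A[OF 1(1) uv] 1 inV
        by (auto simp: T'_def)
      ultimately show ?thesis using 1 by (simp add: A'_def)
    next
      case (2 x)
      have "A {v, x} \<inter> T' y \<noteq> {}" if "y \<in> e" for y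
        using that A_meets[OF 2(2), of v] A_meets[OF 2(2), of x] 2 by (auto simp: T'_def)
      moreover have "A {v, x} \<inter> T' y = {}" if "y \<in> V - {v} - e" for y
        using that A_T[OF 2(2), of y] 2 by (auto simp: T'_def)
      ultimately show ?thesis using 2 by (simp add: A'_def)
    qed
    ultimately show ?thesis by blast
  qed
  moreover have "T' x \<inter> T' y = {}" if "x \<in> V - {v}" "y \<in> V - {v}" "x \<noteq> y" for x y
    using that T_disj[of x y] T_disj[of x v] T_disj[of v y] A_T[OF uv, of x] A_T[OF uv, of y] inV
    by (auto simp: T'_def)
  moreover have "path_connected (T' x) \<and> T' x \<noteq> {}" if "x \<in> V - {v}" for x
    using that blob pc unfolding blob_drawing_def by (auto simp: T'_def)
  ultimately show "blob_drawing (V - {v}) (contract u v E) T' A'"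
    unfolding blob_drawing_def by blast
  have "A' e \<inter> A' f = {}" if e: "e \<in> contract u v E" and f: "f \<in> contract u v E" and ef: "e \<inter> f = {}" for e f
  proof -
    have "contract_origin u v E e \<inter> contract_origin u v E f = {}"
      using contract_cases[OF G e]
    proof cases
      case 1
      then show ?thesis using ef by (cases rule: contract_cases[OF G f]) auto
    next
      case (2 x)
      then show ?thesis using ef by (cases rule: contract_cases[OF G f]) auto
    qed
    then show ?thesis unfolding A'_def using A_A contract_origin_in[OF G] e f by blast
  qed
  then show "independent_disjoint (contract u v E) A'" unfolding independent_disjoint_def by blast
qed

section \<open>A linear edge bound for drawings without meeting independent edges\<close>

lemma sum_incident_edges:
  assumes "simple_graph V E"
  shows "(\<Sum>v\<in>V. card {e \<in> E. v \<in> e}) = 2 * card E"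
proof -
  have fin: "finite V" "finite E" using assms simple_graph_finite_edges by (auto simp: simple_graph_def)
  have "(\<Sum>v\<in>V. card {e \<in> E. v \<in> e}) = (\<Sum>v\<in>V. \<Sum>e\<in>E. if v \<in> e then 1 else 0)"
    using fin by (intro sum.cong refl) (simp add: sum.If_cases Int_def)
  also have "\<dots> = (\<Sum>e\<in>E. \<Sum>v\<in>V. if v \<in> e then 1 else 0)" by (rule sum.swap)
  also have "\<dots> = (\<Sum>e\<in>E. 2)"
  proof (rule sum.cong)
    fix e assume "e \<in> E"
    then have "V \<inter> e = e" "card e = 2" using assms by (auto simp: simple_graph_def)
    then show "(\<Sum>v\<in>V. if v \<in> e then 1 else 0) = (2::nat)" using fin by (simp add: sum.If_cases Int_def)
  qed simp
  finally show ?thesis by simp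
qed

definition neighbours :: "'v set set \<Rightarrow> 'v \<Rightarrow> 'v set" where
  "neighbours E v = {w. {v, w} \<in> E}"

lemma low_degree_vertex:
  assumes G: "simple_graph V E" and few: "card E < 3 * card V"
  shows "\<exists>v\<in>V. card (neighbours E v) \<le> 5"
proof (rule ccontr)
  assume "\<not> ?thesis"
  then have big: "6 \<le> card (neighbours E v)" if "v \<in> V" for v using that by force
  have "6 \<le> card {e \<in> E. v \<in> e}" if "v \<in> V" for v
  proof -
    have "card (neighbours E v) \<le> card {e \<in> E. v \<in> e}"
    proof (rule card_inj_on_le)
      show "inj_on (\<lambda>w. {v, w}) (neighbours E v)" by (auto simp: inj_on_def doubleton_eq_iff)
      show "(\<lambda>w. {v, w}) ` neighbours E v \<subseteq> {e \<in> E. v \<in> e}" by (auto simp: neighbours_def)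
      show "finite {e \<in> E. v \<in> e}" using simple_graph_finite_edges[OF G] by simp
    qed
    then show ?thesis using big[OF that] by simp
  qed
  then have "(\<Sum>v\<in>V. 6) \<le> (\<Sum>v\<in>V. card {e \<in> E. v \<in> e})" by (rule sum_mono)
  then show False using few sum_incident_edges[OF G] by simp
qed

text \<open>
  The neighbourhood \<open>N\<close> has at least four vertices, and each of them misses at most \<open>card N - 4\<close> others in \<open>N\<close>.
  If \<open>N\<close> is complete, there is a \<open>K5\<close> in \<open>N\<close> together with \<open>v\<close>. Otherwise \<open>N\<close> has five vertices and the missing
  edges form a matching that contains some pair \<open>a, b\<close>. Contracting \<open>{a, c}\<close> supplies this pair; when \<open>c\<close> is
  chosen such that the remaining possible missing pair, if any, contains \<open>c\<close>, then \<open>a\<close> supplies it too, and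
  \<open>v, a, b, d, z\<close> form a \<open>K5\<close>.
\<close>

lemma no_dense_neighbourhood:
  assumes G: "simple_graph V E" and blob: "blob_drawing V E T A" and indep: "independent_disjoint E A"
    and common: "\<And>u v. {u, v} \<in> E \<Longrightarrow> 3 \<le> card (neighbours E u \<inter> neighbours E v)"
    and v: "neighbours E v \<noteq> {}" "card (neighbours E v) \<le> 5"
  shows False
proof -
  let ?N = "neighbours E v"
  have sym: "{x, y} \<in> E \<longleftrightarrow> {y, x} \<in> E" for x y by (simp add: insert_commute)
  have NV: "?N \<subseteq> V" using simple_graph_edgeD(2)[OF G] by (auto simp: neighbours_def)
  then have finN: "finite ?N" using G finite_subset by (auto simp: simple_graph_def)
  have vV: "v \<in> V" using v(1) simple_graph_edgeD(1)[OF G] by (auto simp: neighbours_def)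
  have irrefl: "{x, x} \<notin> E" for x using simple_graph_edgeD(3)[OF G] by blast
  have vN: "v \<notin> ?N" using irrefl by (auto simp: neighbours_def)
  have adj_v: "{v, w} \<in> E" if "w \<in> ?N" for w using that by (simp add: neighbours_def)
  have inner: "3 \<le> card {x \<in> ?N - {w}. {w, x} \<in> E}" if "w \<in> ?N" for w
  proof -
    have "?N \<inter> neighbours E w = {x \<in> ?N - {w}. {w, x} \<in> E}" using irrefl by (auto simp: neighbours_def)
    then show ?thesis using common[OF adj_v[OF that]] by simp
  qed
  have nonadj: "card {x \<in> ?N - {w}. {w, x} \<notin> E} \<le> card ?N - 4" if "w \<in> ?N" for w
  proof -
    have "?N - {w} = {x \<in> ?N - {w}. {w, x} \<in> E} \<union> {x \<in> ?N - {w}. {w, x} \<notin> E}" by auto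
    then have "card (?N - {w}) = card {x \<in> ?N - {w}. {w, x} \<in> E} + card {x \<in> ?N - {w}. {w, x} \<notin> E}"
      using finN by (metis (no_types, lifting) Collect_disj_eq card_Un_disjoint disjoint_iff finite_Diff finite_Un mem_Collect_eq)
    then show ?thesis using inner[OF that] that finN by simp
  qed
  have size: "4 \<le> card ?N"
  proof -
    obtain w where w: "w \<in> ?N" using v(1) by blast
    have "card {x \<in> ?N - {w}. {w, x} \<in> E} \<le> card (?N - {w})" using finN by (intro card_mono) auto
    then show ?thesis using inner[OF w] w finN by simp
  qed
  show False
  proof (cases "\<exists>a\<in>?N. \<exists>b\<in>?N. a \<noteq> b \<and> {a, b} \<notin> E")
    case False
    then have cliqueN: "{a, b} \<in> E" if "a \<in> ?N" "b \<in> ?N" "a \<noteq> b" for a b using that by blast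
    have "card (insert v ?N) \<ge> 5" using size vN finN by simp
    then obtain S where S: "S \<subseteq> insert v ?N" "card S = 5" by (meson obtain_subset_with_card_n)
    show False
    proof (rule no_K5_blob_drawing[OF blob indep _ S(2)])
      show "S \<subseteq> V" using S NV vV by blast
      show "{x, y} \<in> E" if "x \<in> S" "y \<in> S" "x \<noteq> y" for x y
        using that S cliqueN adj_v sym by blast
    qed
  next
    case True
    then obtain a b where ab: "a \<in> ?N" "b \<in> ?N" "a \<noteq> b" "{a, b} \<notin> E" by blast
    have uniq: "{w, y} \<in> E" if "w \<in> ?N" "x \<in> ?N" "y \<in> ?N" "w \<noteq> x" "w \<noteq> y" "x \<noteq> y" "{w, x} \<notin> E" for w x y
    proof (rule ccontr)
      assume "{w, y} \<notin> E"
      then have "{x, y} \<subseteq> {x \<in> ?N - {w}. {w, x} \<notin> E}" using that by auto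
      then have "card {x, y} \<le> card {x \<in> ?N - {w}. {w, x} \<notin> E}" using finN by (intro card_mono) auto
      then show False using nonadj[OF that(1)] v(2) that by simp
    qed
    have "card {x \<in> ?N - {a}. {a, x} \<notin> E} \<noteq> 0" using ab finN by auto
    then have "card ?N = 5" using nonadj[OF ab(1)] v(2) size by linarith
    then have "card (?N - {a, b}) = 3" using ab finN by (simp add: card_Diff_subset)
    then obtain c d z where cdz: "?N - {a, b} = {c, d, z}" "c \<noteq> d" "c \<noteq> z" "d \<noteq> z"
      by (auto simp: card_3_iff)
    \<comment> \<open>At most one of the three pairs is missing, so one of the three vertices is adjacent to both others;
      it becomes \<open>z\<close>.\<close>
    obtain c d z where N: "?N = {a, b, c, d, z}" and ne: "c \<noteq> d" "c \<noteq> z" "d \<noteq> z" "a \<notin> {c, d, z}" "b \<notin> {c, d, z}"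
      and zc: "{z, c} \<in> E" and zd: "{z, d} \<in> E"
    proof (cases "{z, c} \<in> E \<and> {z, d} \<in> E")
      case True
      then show ?thesis using cdz ab that[of c d z] by blast
    next
      case False
      have inN: "c \<in> ?N" "d \<in> ?N" "z \<in> ?N" using cdz by blast+
      have "({c, z} \<in> E \<and> {c, d} \<in> E) \<or> ({d, z} \<in> E \<and> {d, c} \<in> E)"
      proof (cases "{z, c} \<in> E")
        case True
        then have "{z, d} \<notin> E" using False by blast
        then have "{d, c} \<in> E" "{z, c} \<in> E" using uniq[of d z c] uniq[of z d c] inN cdz sym by blast+
        then show ?thesis using sym by blast
      next
        case zc: False
        then have "{z, d} \<in> E" "{c, d} \<in> E" using uniq[of z c d] uniq[of c z d] inN cdz sym by blast+
        then show ?thesis using sym by blast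
      qed
      then show ?thesis using that[of d z c] that[of c z d] cdz ab by blast
    qed
    have adj_a: "{a, x} \<in> E" if "x \<in> {c, d, z}" for x using uniq[of a b x] ab N ne that by blast
    have adj_b: "{b, x} \<in> E" if "x \<in> {c, d, z}" for x
      using uniq[of b a x] ab N ne that sym by blast
    have ac: "{a, c} \<in> E" using adj_a by blast
    have nv: "v \<notin> {a, b, c, d, z}" using vN N by blast
    have keep: "{x, y} \<in> contract a c E" if "{x, y} \<in> E" "x \<noteq> c" "y \<noteq> c" for x y
      using that by (auto simp: contract_def)
    have "insert a ({b, c} - {c}) = {a, b}" using ne by auto
    then have a_b: "{a, b} \<in> contract a c E"
      using adj_b[of c] ab ne unfolding contract_def by (intro UnI2 image_eqI[of _ _ "{b, c}"]) auto
    let ?S = "{v, a, b, d, z}"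
    show False
    proof (rule no_K5_blob_drawing[OF blob_drawing_contract[OF G blob indep ac], of ?S])
      show "?S \<subseteq> V - {c}" using N NV vV nv ne by auto
      show "card ?S = 5" using ab ne nv by simp
      have v_x: "{v, x} \<in> contract a c E" if "x \<in> {a, b, d, z}" for x
        using that N ne nv ab by (intro keep adj_v) auto
      have edges: "{v, a} \<in> contract a c E" "{v, b} \<in> contract a c E" "{v, d} \<in> contract a c E"
        "{v, z} \<in> contract a c E" "{a, d} \<in> contract a c E" "{a, z} \<in> contract a c E"
        "{b, d} \<in> contract a c E" "{b, z} \<in> contract a c E" "{z, d} \<in> contract a c E"
        using ne by (auto intro!: v_x keep adj_a adj_b zd)
      show "{x, y} \<in> contract a c E" if "x \<in> ?S" "y \<in> ?S" "x \<noteq> y" for x y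
        using that edges a_b by (auto simp: insert_commute)
    qed
  qed
qed

lemma card_contract_le:
  assumes G: "simple_graph V E"
  shows "card (contract u v E) \<le> card E"
proof (rule card_inj_on_le)
  show "inj_on (contract_origin u v E) (contract u v E)"
  proof (rule inj_onI)
    fix e f assume e: "e \<in> contract u v E" and f: "f \<in> contract u v E"
      and eq: "contract_origin u v E e = contract_origin u v E f"
    from G e show "e = f"
    proof (cases rule: contract_cases)
      case e1: 1
      from G f show ?thesis
      proof (cases rule: contract_cases)
        case 1
        then show ?thesis using e1 eq by simp
      next
        case (2 y)
        then have "e = {v, y}" using e1 eq by simp
        then show ?thesis using e1 by simp
      qed
    next
      case e2: (2 x)
      from G f show ?thesis
      proof (cases rule: contract_cases)
        case 1
        then have "f = {v, x}" using e2 eq by simp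
        then show ?thesis using 1 by simp
      next
        case (2 y)
        then have "{v, x} = {v, y}" using e2 eq by simp
        then show ?thesis using e2 2 by (auto simp: doubleton_eq_iff)
      qed
    qed
  qed
  show "contract_origin u v E ` contract u v E \<subseteq> E" using contract_origin_in[OF G] by blast
qed (rule simple_graph_finite_edges[OF G])

text \<open>
  In a minimal counterexample, deleting any edge restores the bound, so \<open>card E = 3 * card V - 2\<close> and some
  vertex has degree at most \<open>5\<close>. If an edge were in at most two triangles, contracting it would lose at most
  three edges and one vertex, against minimality; so that vertex is isolated and can be deleted, or it has a
  neighbourhood as excluded above. The constant \<open>3\<close>, instead of the \<open>6\<close> of the usual planar bound, makes the
  statement true from a single vertex on. Without it, a minimal counterexample would have average degree
  above \<open>6\<close>.
\<close>

theorem edge_bound_independent_disjoint: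
  assumes "simple_graph V E" "blob_drawing V E T A" "independent_disjoint E A" "V \<noteq> {}"
  shows "card E + 3 \<le> 3 * card V"
  using assms
proof (induction "card V + card E" arbitrary: V E T A rule: less_induct)
  case less
  note G = less.prems(1) and blob = less.prems(2) and indep = less.prems(3)
  have finV: "finite V" using G by (simp add: simple_graph_def)
  have finE: "finite E" using simple_graph_finite_edges[OF G] .
  have Vpos: "1 \<le> card V" using finV less.prems(4) by (simp add: Suc_leI card_gt_0_iff)
  show ?case
  proof (rule ccontr)
    assume contra: "\<not> ?thesis"
    then have "E \<noteq> {}" using Vpos by auto
    then obtain e0 where e0: "e0 \<in> E" by blast
    have "card (E - {e0}) + 3 \<le> 3 * card V"
    proof (rule less.hyps[of V "E - {e0}" T A])
      show "card V + card (E - {e0}) < card V + card E" using card_Diff1_less[OF finE e0] by simp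
      show "simple_graph V (E - {e0})" by (rule simple_graph_mono[OF G]) blast
      show "blob_drawing V (E - {e0}) T A" by (rule blob_drawing_mono[OF blob]) blast+
      show "independent_disjoint (E - {e0}) A" by (rule independent_disjoint_mono[OF indep]) blast
    qed (rule less.prems(4))
    then have few: "card E < 3 * card V" using finE e0 contra by simp
    have common: "3 \<le> card (neighbours E u \<inter> neighbours E v)" if uv: "{u, v} \<in> E" for u v
    proof (rule ccontr)
      assume c: "\<not> 3 \<le> card (neighbours E u \<inter> neighbours E v)"
      have eq: "neighbours E u \<inter> neighbours E v = {x. {u, x} \<in> E \<and> {v, x} \<in> E}"
        by (auto simp: neighbours_def)
      note uvV = simple_graph_edgeD[OF G uv]
      have smaller: "card (V - {v}) + card (contract u v E) < card V + card E"
      proof -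
        have "card (contract u v E) \<le> card E" by (rule card_contract_le[OF G])
        then show ?thesis using card_Diff1_less[OF finV uvV(2)] by linarith
      qed
      have "card (contract u v E) + 3 \<le> 3 * card (V - {v})"
        using less.hyps[OF smaller simple_graph_contract[OF G uv] blob_drawing_contract[OF G blob indep uv]] uvV by blast
      then show False using card_contract[OF G uv] c contra eq finV uvV by simp
    qed
    obtain v where v: "v \<in> V" "card (neighbours E v) \<le> 5" using low_degree_vertex[OF G few] by blast
    show False
    proof (cases "neighbours E v = {}")
      case True
      have "v \<notin> e" if "e \<in> E" for e
        using True simple_graph_edgeE[OF G that] that by (metis empty_iff mem_Collect_eq neighbours_def)
      then have G': "simple_graph (V - {v}) E" using G by (auto simp: simple_graph_def)
      have "V - {v} \<noteq> {}"
      proof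
        assume "V - {v} = {}"
        then have "e0 \<subseteq> {}" "card e0 = 2" using G' e0 unfolding simple_graph_def by metis+
        then show False by simp
      qed
      then have "card E + 3 \<le> 3 * card (V - {v})"
        using less.hyps[of "V - {v}" E T A] G' blob_drawing_mono[OF blob, of "V - {v}" E] indep
          card_Diff1_less[OF finV v(1)] by simp
      then show False using contra finV v by simp
    next
      case False
      then show False using no_dense_neighbourhood[OF G blob indep common _ v(2)] by blast
    qed
  qed
qed

section \<open>The crossing lemma\<close>

text \<open>
  A random subset of \<open>V\<close> that contains each vertex independently with probability \<open>q\<close> includes \<open>S\<close> with
  probability \<open>q ^ card S\<close>.
\<close>

lemma sum_subset_weights:
  fixes q :: real
  assumes "finite V" "S \<subseteq> V"
  shows "(\<Sum>W | W \<subseteq> V \<and> S \<subseteq> W. q ^ card W * (1 - q) ^ card (V - W)) = q ^ card S"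
proof -
  let ?w = "\<lambda>W. q ^ card W * (1 - q) ^ card (V - W)"
  \<comment> \<open>Expand the product over \<open>V\<close> whose factor at \<open>x\<close> is \<open>q + (1 - q)\<close> off \<open>S\<close> and \<open>q + 0\<close> on \<open>S\<close>.\<close>
  define r where "r x = (if x \<in> S then 0 else 1 - q)" for x
  have "(\<Sum>W | W \<subseteq> V \<and> S \<subseteq> W. ?w W) = (\<Sum>W\<in>Pow V. if S \<subseteq> W then ?w W else 0)"
    using assms(1) by (simp add: sum.If_cases Int_def)
  also have "\<dots> = (\<Sum>W\<in>Pow V. (\<Prod>x\<in>W. q) * (\<Prod>x\<in>V - W. r x))"
  proof (rule sum.cong)
    fix W assume W: "W \<in> Pow V"
    show "(if S \<subseteq> W then ?w W else 0) = (\<Prod>x\<in>W. q) * (\<Prod>x\<in>V - W. r x)"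
    proof (cases "S \<subseteq> W")
      case True
      then have "(\<Prod>x\<in>V - W. r x) = (\<Prod>x\<in>V - W. 1 - q)" by (intro prod.cong) (auto simp: r_def)
      then show ?thesis using True by simp
    next
      case False
      then have "(\<Prod>x\<in>V - W. r x) = 0" using assms by (intro prod_zero) (auto simp: r_def)
      then show ?thesis using False by simp
    qed
  qed simp
  also have "\<dots> = (\<Prod>x\<in>V. q + r x)" by (rule prod_add[OF assms(1), symmetric])
  also have "\<dots> = (\<Prod>x\<in>V. if x \<in> S then q else 1)" by (intro prod.cong) (auto simp: r_def)
  also have "\<dots> = q ^ card S" using assms by (simp add: prod.If_cases Int_absorb1)
  finally show ?thesis .
qed

text \<open>
  Linearity of expectation, for the random subset of the preceding lemma.
\<close>

lemma expected_count:
  fixes q :: real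
  assumes "finite V" "finite X" "\<And>x. x \<in> X \<Longrightarrow> s x \<subseteq> V"
  shows "(\<Sum>W\<in>Pow V. q ^ card W * (1 - q) ^ card (V - W) * card {x \<in> X. s x \<subseteq> W}) = (\<Sum>x\<in>X. q ^ card (s x))"
proof -
  let ?w = "\<lambda>W. q ^ card W * (1 - q) ^ card (V - W)"
  have "(\<Sum>W\<in>Pow V. ?w W * card {x \<in> X. s x \<subseteq> W}) = (\<Sum>W\<in>Pow V. \<Sum>x\<in>X. if s x \<subseteq> W then ?w W else 0)"
    using assms(2) by (intro sum.cong refl) (simp add: sum.If_cases Int_def)
  also have "\<dots> = (\<Sum>x\<in>X. \<Sum>W\<in>Pow V. if s x \<subseteq> W then ?w W else 0)" by (rule sum.swap)
  also have "\<dots> = (\<Sum>x\<in>X. \<Sum>W | W \<subseteq> V \<and> s x \<subseteq> W. ?w W)"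
    using assms(1) by (simp add: sum.If_cases Int_def)
  also have "\<dots> = (\<Sum>x\<in>X. q ^ card (s x))"
    using assms by (intro sum.cong refl sum_subset_weights) auto
  finally show ?thesis .
qed

text \<open>
  Each unordered pair is counted once, however often its two edges meet; adjacent edges are never counted.
\<close>

definition crossing_pairs :: "'v set set \<Rightarrow> ('v set \<Rightarrow> complex set) \<Rightarrow> 'v set set set" where
  "crossing_pairs E A = {{e, f} | e f. e \<in> E \<and> f \<in> E \<and> e \<inter> f = {} \<and> A e \<inter> A f \<noteq> {}}"

lemma crossing_pairsE:
  assumes "P \<in> crossing_pairs E A"
  obtains e f where "P = {e, f}" "e \<in> E" "f \<in> E" "e \<inter> f = {}" "A e \<inter> A f \<noteq> {}"
  using assms unfolding crossing_pairs_def by blast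

lemma crossing_pairsI:
  "e \<in> E \<Longrightarrow> f \<in> E \<Longrightarrow> e \<inter> f = {} \<Longrightarrow> A e \<inter> A f \<noteq> {} \<Longrightarrow> {e, f} \<in> crossing_pairs E A"
  unfolding crossing_pairs_def by blast

lemma crossing_pairs_within:
  "crossing_pairs {e \<in> E. e \<subseteq> W} A = {P \<in> crossing_pairs E A. \<Union>P \<subseteq> W}"
proof (intro equalityI subsetI)
  fix P assume "P \<in> crossing_pairs {e \<in> E. e \<subseteq> W} A"
  then obtain e f where P: "P = {e, f}" and ef: "e \<in> {e \<in> E. e \<subseteq> W}" "f \<in> {e \<in> E. e \<subseteq> W}" "e \<inter> f = {}" "A e \<inter> A f \<noteq> {}"
    by (rule crossing_pairsE)
  then have "P \<in> crossing_pairs E A" unfolding P by (intro crossing_pairsI) simp_all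
  then show "P \<in> {P \<in> crossing_pairs E A. \<Union>P \<subseteq> W}" using P ef by simp
next
  fix P assume "P \<in> {P \<in> crossing_pairs E A. \<Union>P \<subseteq> W}"
  then have "P \<in> crossing_pairs E A" and W: "\<Union>P \<subseteq> W" by simp_all
  then obtain e f where P: "P = {e, f}" and ef: "e \<in> E" "f \<in> E" "e \<inter> f = {}" "A e \<inter> A f \<noteq> {}"
    by (elim crossing_pairsE)
  then show "P \<in> crossing_pairs {e \<in> E. e \<subseteq> W} A"
    using W unfolding P by (intro crossing_pairsI) simp_all
qed

lemma crossing_pairs_subset: "crossing_pairs E A \<subseteq> Pow E"
  by (auto elim!: crossing_pairsE)

text \<open>
  Removing one edge of each crossing pair leaves a drawing in which independent edges are disjoint.
\<close>

lemma edges_le_crossing_pairs: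
  assumes G: "simple_graph V E" and blob: "blob_drawing V E T A"
  shows "card E \<le> 3 * card V + card (crossing_pairs E A)"
proof (cases "V = {}")
  case True
  then have "E = {}" using G by (auto simp: simple_graph_def)
  then show ?thesis by simp
next
  case False
  let ?P = "crossing_pairs E A"
  have finE: "finite E" using simple_graph_finite_edges[OF G] .
  then have finP: "finite ?P" using crossing_pairs_subset finite_subset by (metis finite_Pow_iff)
  define pick where "pick P = (SOME e. e \<in> P)" for P :: "'a set set"
  have pick: "pick P \<in> P" if P: "P \<in> ?P" for P
  proof -
    from P obtain e where "e \<in> P" by (auto elim: crossing_pairsE)
    then show ?thesis unfolding pick_def by (rule someI)
  qed
  let ?E' = "E - pick ` ?P"
  have "independent_disjoint ?E' A"
    unfolding independent_disjoint_def
  proof (intro ballI impI, rule ccontr)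
    fix e f assume ef: "e \<in> ?E'" "f \<in> ?E'" "e \<inter> f = {}" "A e \<inter> A f \<noteq> {}"
    then have "{e, f} \<in> ?P" by (intro crossing_pairsI) auto
    then have "e \<in> pick ` ?P \<or> f \<in> pick ` ?P" using pick[of "{e, f}"] by force
    then show False using ef by blast
  qed
  then have "card ?E' + 3 \<le> 3 * card V"
    by (intro edge_bound_independent_disjoint[of V ?E' T A] simple_graph_mono[OF G] blob_drawing_mono[OF blob] False) auto
  moreover have "card E \<le> card ?E' + card (pick ` ?P)"
  proof -
    have "card E \<le> card (?E' \<union> pick ` ?P)" using finE finP by (intro card_mono) auto
    then show ?thesis using card_Un_le[of ?E' "pick ` ?P"] by linarith
  qed
  moreover have "card (pick ` ?P) \<le> card ?P" using card_image_le[OF finP] .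
  ultimately show ?thesis by linarith
qed

text \<open>
  Averaging the preceding bound over the subgraphs induced by random vertex sets with probability \<open>q\<close> gives
  \<open>q\<^sup>2 m \<le> 3 q n + q\<^sup>4 k\<close>, because crossing pairs span four vertices. The choice \<open>q = 4 n / m\<close>
  yields the claim.
\<close>

theorem crossing_lemma:
  assumes G: "simple_graph V E" and blob: "blob_drawing V E T A" and dense: "4 * card V \<le> card E"
  shows "real (card E) ^ 3 \<le> 64 * real (card V) ^ 2 * real (card (crossing_pairs E A))"
proof (cases "card V = 0")
  case True
  then have "E = {}" using G by (auto simp: simple_graph_def)
  then show ?thesis by simp
next
  case False
  define n m k where "n = real (card V)" and "m = real (card E)" and "k = real (card (crossing_pairs E A))"
  have n: "n > 0" and m: "4 * n \<le> m" using False dense by (auto simp: n_def m_def)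
  then have m0: "m > 0" by linarith
  define q where "q = 4 * n / m"
  have q: "0 < q" "q \<le> 1" using n m m0 by (auto simp: q_def)
  have finV: "finite V" using G by (simp add: simple_graph_def)
  have finE: "finite E" using simple_graph_finite_edges[OF G] .
  then have finP: "finite (crossing_pairs E A)" using crossing_pairs_subset finite_subset by (metis finite_Pow_iff)
  have edge: "e \<subseteq> V" "card e = 2" if "e \<in> E" for e using G that by (auto simp: simple_graph_def)
  have pair: "\<Union>P \<subseteq> V" "card (\<Union>P) = 4" if P: "P \<in> crossing_pairs E A" for P
  proof -
    from P obtain e f where ef: "P = {e, f}" "e \<in> E" "f \<in> E" "e \<inter> f = {}" by (rule crossing_pairsE)
    show "\<Union>P \<subseteq> V" using ef edge by auto
    have "finite e" "finite f" using edge ef finV finite_subset by blast+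
    then show "card (\<Union>P) = 4" using ef edge(2) by (simp add: card_Un_disjoint)
  qed
  let ?w = "\<lambda>W. q ^ card W * (1 - q) ^ card (V - W)"
  have local_bound: "real (card {e \<in> E. e \<subseteq> W})
      \<le> 3 * real (card {v \<in> V. {v} \<subseteq> W}) + real (card {P \<in> crossing_pairs E A. \<Union>P \<subseteq> W})" if W: "W \<subseteq> V" for W
  proof -
    let ?E = "{e \<in> E. e \<subseteq> W}"
    have "simple_graph W ?E" using G W finite_subset by (auto simp: simple_graph_def)
    moreover have "blob_drawing W ?E T A" by (rule blob_drawing_mono[OF blob W]) auto
    ultimately have "card ?E \<le> 3 * card W + card (crossing_pairs ?E A)" by (rule edges_le_crossing_pairs)
    moreover have "crossing_pairs ?E A = {P \<in> crossing_pairs E A. \<Union>P \<subseteq> W}"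
      by (rule crossing_pairs_within)
    moreover have "{v \<in> V. {v} \<subseteq> W} = W" using W by auto
    ultimately show ?thesis by simp
  qed
  have "q ^ 2 * m = (\<Sum>W\<in>Pow V. ?w W * card {e \<in> E. e \<subseteq> W})"
    using expected_count[OF finV finE, of "\<lambda>e. e" q] edge by (simp add: m_def)
  also have "\<dots> \<le> (\<Sum>W\<in>Pow V. ?w W * (3 * real (card {v \<in> V. {v} \<subseteq> W}) + real (card {P \<in> crossing_pairs E A. \<Union>P \<subseteq> W})))"
    using q local_bound by (intro sum_mono mult_left_mono) auto
  also have "\<dots> = 3 * (\<Sum>W\<in>Pow V. ?w W * card {v \<in> V. {v} \<subseteq> W})
      + (\<Sum>W\<in>Pow V. ?w W * card {P \<in> crossing_pairs E A. \<Union>P \<subseteq> W})"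
    by (simp add: sum_distrib_left sum.distrib algebra_simps)
  also have "(\<Sum>W\<in>Pow V. ?w W * card {v \<in> V. {v} \<subseteq> W}) = q * n"
    using expected_count[OF finV finV, of "\<lambda>v. {v}" q] by (simp add: n_def)
  also have "(\<Sum>W\<in>Pow V. ?w W * card {P \<in> crossing_pairs E A. \<Union>P \<subseteq> W}) = q ^ 4 * k"
    using expected_count[OF finV finP, of "\<lambda>P. \<Union>P" q] pair by (simp add: k_def)
  finally have "q ^ 2 * m \<le> 3 * (q * n) + q ^ 4 * k" .
  then have "(4 * n) ^ 2 * m ^ 3 \<le> 12 * n ^ 2 * m ^ 3 + (4 * n) ^ 4 * k"
    using m0 by (simp add: q_def field_simps power2_eq_square power3_eq_cube power4_eq_xxxx)
  then have "4 * n ^ 2 * m ^ 3 \<le> 4 * n ^ 2 * (64 * n ^ 2 * k)"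
    by (simp add: power_mult_distrib algebra_simps flip: power_add)
  then have "m ^ 3 \<le> 64 * n ^ 2 * k"
    by (subst (asm) mult_le_cancel_left_pos) (use n in simp_all)
  then show ?thesis by (simp add: n_def m_def k_def)
qed

section \<open>Models of graphs by routes\<close>

text \<open>
  A model sends vertices injectively to branch vertices and every edge \<open>e\<close> to a set \<open>F e\<close> of edges that connects
  the images of its ends. Two routes share at most the image of a common end, and no route runs through a foreign branch
  vertex. The degree conditions make a route look like a path locally, so that in the union of all routes only
  branch vertices can have degree at least \<open>3\<close>; components of a route away from the path are harmless. Compared
  with lists of vertices, sets of edges make composition a plain union.
\<close>

locale topological_model =
  fixes V :: "'v set" and E :: "'v set set" and V' :: "'w set" and E' :: "'w set set"
    and \<phi> :: "'v \<Rightarrow> 'w" and F :: "'v set \<Rightarrow> 'w set set"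
  assumes source: "simple_graph V E" and target: "simple_graph V' E'"
    and inj: "inj_on \<phi> V" and branch_in: "\<phi> ` V \<subseteq> V'"
    and route: "e \<in> E \<Longrightarrow> F e \<subseteq> E'"
    and connects: "{u, v} \<in> E \<Longrightarrow> (\<phi> u, \<phi> v) \<in> {(x, y). {x, y} \<in> F {u, v}}\<^sup>*"
    and avoids: "e \<in> E \<Longrightarrow> v \<in> V \<Longrightarrow> \<phi> v \<in> \<Union>(F e) \<Longrightarrow> v \<in> e"
    and meet: "e \<in> E \<Longrightarrow> f \<in> E \<Longrightarrow> e \<noteq> f \<Longrightarrow> \<Union>(F e) \<inter> \<Union>(F f) \<subseteq> \<phi> ` (e \<inter> f)"
    and degree_inner: "e \<in> E \<Longrightarrow> x \<notin> \<phi> ` V \<Longrightarrow> card {d \<in> F e. x \<in> d} \<le> 2"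
    and degree_end: "e \<in> E \<Longrightarrow> v \<in> e \<Longrightarrow> card {d \<in> F e. \<phi> v \<in> d} \<le> 1"
begin

lemma routes_disjoint:
  assumes "e \<in> E" "f \<in> E" "e \<noteq> f"
  shows "F e \<inter> F f = {}"
proof (rule ccontr)
  assume "F e \<inter> F f \<noteq> {}"
  then obtain d where d: "d \<in> F e" "d \<in> F f" by blast
  then have "d \<subseteq> \<phi> ` (e \<inter> f)" using meet[OF assms] by blast
  moreover have ef: "card e = 2" "card f = 2" using source assms by (auto simp: simple_graph_def)
  then have fin: "finite e" "finite f" by (auto intro: card_ge_0_finite)
  ultimately have "card d \<le> card (e \<inter> f)"
    by (meson card_image_le card_mono finite_Int finite_imageI order_trans)
  moreover have "card d = 2" using d(1) route[OF assms(1)] target by (auto simp: simple_graph_def)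
  ultimately have "card (e \<inter> f) \<ge> 2" by simp
  then have "e \<inter> f = e" "e \<inter> f = f" using card_seteq[of e "e \<inter> f"] card_seteq[of f "e \<inter> f"] ef fin by auto
  then show False using assms(3) by simp
qed

lemma finite_route: "e \<in> E \<Longrightarrow> finite (F e)"
  using route simple_graph_finite_edges[OF target] finite_subset by blast

text \<open>
  Every edge of \<open>S\<close> at \<open>v\<close> contributes at most one edge at \<open>\<phi> v\<close>, so composing models does not increase degrees.
\<close>

lemma card_route_at_branch:
  assumes "S \<subseteq> E" "v \<in> V"
  shows "card {d \<in> \<Union>(F ` S). \<phi> v \<in> d} \<le> card {e \<in> S. v \<in> e}"
proof -
  have finS: "finite S" using assms(1) simple_graph_finite_edges[OF source] finite_subset by blast
  have "{d \<in> \<Union>(F ` S). \<phi> v \<in> d} \<subseteq> (\<Union>e\<in>{e \<in> S. v \<in> e}. {d \<in> F e. \<phi> v \<in> d})"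
    using avoids assms by blast
  moreover have "finite (\<Union>e\<in>{e \<in> S. v \<in> e}. {d \<in> F e. \<phi> v \<in> d})"
    using finS finite_route assms(1) by auto
  ultimately have "card {d \<in> \<Union>(F ` S). \<phi> v \<in> d} \<le> card (\<Union>e\<in>{e \<in> S. v \<in> e}. {d \<in> F e. \<phi> v \<in> d})"
    by (rule card_mono[rotated])
  also have "\<dots> \<le> (\<Sum>e\<in>{e \<in> S. v \<in> e}. card {d \<in> F e. \<phi> v \<in> d})"
    using finS by (intro card_UN_le) simp
  also have "\<dots> \<le> (\<Sum>e\<in>{e \<in> S. v \<in> e}. 1)"
    using assms(1) degree_end by (intro sum_mono) auto
  finally show ?thesis by simp
qed

end

text \<open>
  Distinct edges of \<open>E\<close> have disjoint routes in \<open>E'\<close>, so the routes of the second model that make up two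
  composite routes can only meet in images of common vertices. A vertex inside a composite route is either a
  branch vertex of the second model, where degrees are inherited from the first route, or lies in a single
  route of the second model.
\<close>

lemma topological_model_trans:
  assumes "topological_model V E V' E' \<phi> F" "topological_model V' E' V'' E'' \<psi> K"
  shows "topological_model V E V'' E'' (\<psi> \<circ> \<phi>) (\<lambda>e. \<Union>(K ` F e))"
proof -
  interpret M: topological_model V E V' E' \<phi> F by fact
  interpret N: topological_model V' E' V'' E'' \<psi> K by fact
  show ?thesis
  proof
    show "simple_graph V E" by (rule M.source)
    show "simple_graph V'' E''" by (rule N.target)
    show "inj_on (\<psi> \<circ> \<phi>) V" using M.inj M.branch_in N.inj by (meson comp_inj_on inj_on_subset)
    show "(\<psi> \<circ> \<phi>) ` V \<subseteq> V''" using M.branch_in N.branch_in by auto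
  next
    fix e assume "e \<in> E"
    then show "\<Union>(K ` F e) \<subseteq> E''" using M.route N.route by blast
  next
    fix u v assume uv: "{u, v} \<in> E"
    let ?R = "{(x, y). {x, y} \<in> \<Union>(K ` F {u, v})}"
    from M.connects[OF uv] have "(\<psi> (\<phi> u), \<psi> (\<phi> v)) \<in> ?R\<^sup>*"
    proof (induction rule: rtrancl_induct)
      case base
      then show ?case by simp
    next
      case (step y z)
      have yz: "{y, z} \<in> F {u, v}" using step.hyps(2) by simp
      then have "{y, z} \<in> E'" using M.route[OF uv] by blast
      then have "(\<psi> y, \<psi> z) \<in> {(a, b). {a, b} \<in> K {y, z}}\<^sup>*" by (rule N.connects)
      moreover have "{(a, b). {a, b} \<in> K {y, z}} \<subseteq> ?R" using yz by blast
      ultimately have "(\<psi> y, \<psi> z) \<in> ?R\<^sup>*" using rtrancl_mono by blast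
      then show ?case using step.IH by (rule rtrancl_trans[rotated])
    qed
    then show "((\<psi> \<circ> \<phi>) u, (\<psi> \<circ> \<phi>) v) \<in> ?R\<^sup>*" by simp
  next
    fix e v assume e: "e \<in> E" and v: "v \<in> V" and x: "(\<psi> \<circ> \<phi>) v \<in> \<Union>(\<Union>(K ` F e))"
    then obtain d where d: "d \<in> F e" "\<psi> (\<phi> v) \<in> \<Union>(K d)" by auto
    then have "\<phi> v \<in> d" using N.avoids[of d "\<phi> v"] M.route[OF e] M.branch_in v by blast
    then show "v \<in> e" using M.avoids[OF e v] d by blast
  next
    fix e f assume e: "e \<in> E" and f: "f \<in> E" and ef: "e \<noteq> f"
    show "\<Union>(\<Union>(K ` F e)) \<inter> \<Union>(\<Union>(K ` F f)) \<subseteq> (\<psi> \<circ> \<phi>) ` (e \<inter> f)"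
    proof
      fix x assume "x \<in> \<Union>(\<Union>(K ` F e)) \<inter> \<Union>(\<Union>(K ` F f))"
      then obtain d d' where d: "d \<in> F e" "d' \<in> F f" "x \<in> \<Union>(K d)" "x \<in> \<Union>(K d')" by blast
      have "d \<noteq> d'" using M.routes_disjoint[OF e f ef] d by blast
      moreover have "d \<in> E'" "d' \<in> E'" using M.route e f d by blast+
      ultimately obtain y where y: "x = \<psi> y" "y \<in> d" "y \<in> d'" using N.meet[of d d'] d by blast
      then have "y \<in> \<phi> ` (e \<inter> f)" using M.meet[OF e f ef] d by blast
      then show "x \<in> (\<psi> \<circ> \<phi>) ` (e \<inter> f)" using y by auto
    qed
  next
    fix e x assume e: "e \<in> E" and x: "x \<notin> (\<psi> \<circ> \<phi>) ` V"
    show "card {d \<in> \<Union>(K ` F e). x \<in> d} \<le> 2"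
    proof (cases "x \<in> \<psi> ` V'")
      case True
      then obtain y where y: "x = \<psi> y" "y \<in> V'" by blast
      then have "y \<notin> \<phi> ` V" using x by auto
      then have "card {d \<in> F e. y \<in> d} \<le> 2" by (rule M.degree_inner[OF e])
      then show ?thesis using N.card_route_at_branch[OF M.route[OF e] y(2)] y(1) by simp
    next
      case False
      show ?thesis
      proof (cases "\<exists>a\<in>F e. x \<in> \<Union>(K a)")
        case True
        then obtain a where a: "a \<in> F e" "x \<in> \<Union>(K a)" by blast
        have aE: "a \<in> E'" using M.route[OF e] a by blast
        have "b = a" if b: "b \<in> F e" "x \<in> \<Union>(K b)" for b
        proof (rule ccontr)
          assume "b \<noteq> a"
          moreover have "b \<in> E'" using M.route[OF e] b by blast
          ultimately have "x \<in> \<psi> ` (b \<inter> a)" using N.meet[of b a] aE a b by blast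
          moreover have "a \<subseteq> V'" using aE N.source by (simp add: simple_graph_def)
          ultimately show False using False by blast
        qed
        then have "{d \<in> \<Union>(K ` F e). x \<in> d} \<subseteq> {d \<in> K a. x \<in> d}" by blast
        then have "card {d \<in> \<Union>(K ` F e). x \<in> d} \<le> card {d \<in> K a. x \<in> d}"
          using N.finite_route[OF aE] by (intro card_mono) auto
        also have "\<dots> \<le> 2" by (rule N.degree_inner[OF aE False])
        finally show ?thesis .
      next
        case False
        then have empty: "{d \<in> \<Union>(K ` F e). x \<in> d} = {}" by blast
        show ?thesis unfolding empty by simp
      qed
    qed
  next
    fix e v assume e: "e \<in> E" and v: "v \<in> e"
    then have "v \<in> V" using M.source by (auto simp: simple_graph_def)
    then have "\<phi> v \<in> V'" using M.branch_in by blast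
    then have "card {d \<in> \<Union>(K ` F e). \<psi> (\<phi> v) \<in> d} \<le> card {d \<in> F e. \<phi> v \<in> d}"
      by (rule N.card_route_at_branch[OF M.route[OF e]])
    also have "\<dots> \<le> 1" by (rule M.degree_end[OF e v])
    finally show "card {d \<in> \<Union>(K ` F e). (\<psi> \<circ> \<phi>) v \<in> d} \<le> 1" by simp
  qed
qed

lemma topological_model_embedding:
  assumes G: "simple_graph V E" and H: "simple_graph V' E'" and inj: "inj_on \<phi> V"
    and "\<phi> ` V \<subseteq> V'" and edge: "\<And>e. e \<in> E \<Longrightarrow> \<phi> ` e \<in> E'"
  shows "topological_model V E V' E' \<phi> (\<lambda>e. {\<phi> ` e})"
proof
  have le1: "card {d \<in> {s}. x \<in> d} \<le> 1" for s :: "'b set" and x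
    using card_mono[of "{s}" "{d \<in> {s}. x \<in> d}"] by auto
  show "card {d \<in> {\<phi> ` e}. x \<in> d} \<le> 2" for e x using le1[of "\<phi> ` e" x] by linarith
  show "card {d \<in> {\<phi> ` e}. \<phi> v \<in> d} \<le> 1" for e v by (rule le1)
  have sub: "e \<subseteq> V" if "e \<in> E" for e using G that by (simp add: simple_graph_def)
  show "\<Union>{\<phi> ` e} \<inter> \<Union>{\<phi> ` f} \<subseteq> \<phi> ` (e \<inter> f)" if "e \<in> E" "f \<in> E" for e f
    using inj_on_image_Int[OF inj sub[OF that(1)] sub[OF that(2)]] by simp
  show "v \<in> e" if "e \<in> E" "v \<in> V" "\<phi> v \<in> \<Union>{\<phi> ` e}" for e v
    using inj_on_image_mem_iff[OF inj that(2) sub[OF that(1)]] that(3) by simp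
  show "(\<phi> u, \<phi> v) \<in> {(x, y). {x, y} \<in> {\<phi> ` {u, v}}}\<^sup>*" for u v by (rule r_into_rtrancl) simp
qed (use assms in auto)

lemma topological_model_subdivide:
  assumes G: "simple_graph V E" and uv: "{u, v} \<in> E" and w: "w \<notin> V"
  shows "topological_model V E (insert w V) (E - {{u, v}} \<union> {{u, w}, {w, v}}) id
    (\<lambda>e. if e = {u, v} then {{u, w}, {w, v}} else {e})" (is "topological_model V E ?V ?E id ?F")
proof
  note uvV = simple_graph_edgeD[OF G uv]
  have sub: "e \<subseteq> V" "card e = 2" if "e \<in> E" for e using G that by (auto simp: simple_graph_def)
  have uw: "u \<noteq> w" "v \<noteq> w" using uvV w by auto
  show "simple_graph V E" by fact
  show "simple_graph ?V ?E" using G uvV uw unfolding simple_graph_def by auto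
  show "inj_on id V" "id ` V \<subseteq> ?V" by auto
  show "?F e \<subseteq> ?E" if "e \<in> E" for e using that by auto
  show "(id a, id b) \<in> {(x, y). {x, y} \<in> ?F {a, b}}\<^sup>*" if "{a, b} \<in> E" for a b
  proof (cases "{a, b} = {u, v}")
    case True
    then have "(a, w) \<in> {(x, y). {x, y} \<in> ?F {a, b}}" "(w, b) \<in> {(x, y). {x, y} \<in> ?F {a, b}}"
      by (auto simp: doubleton_eq_iff insert_commute)
    then show ?thesis unfolding id_apply by (rule rtrancl_into_rtrancl[OF r_into_rtrancl])
  next
    case False
    then show ?thesis by (intro r_into_rtrancl) simp
  qed
  show "x \<in> e" if "e \<in> E" "x \<in> V" "id x \<in> \<Union>(?F e)" for e x
    using that w by (auto split: if_splits)
  show "\<Union>(?F e) \<inter> \<Union>(?F f) \<subseteq> id ` (e \<inter> f)" if "e \<in> E" "f \<in> E" "e \<noteq> f" for e f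
    using that w sub(1)[OF that(1)] sub(1)[OF that(2)] by (auto split: if_splits)
  have "card (?F e) \<le> 2" for e using card_insert_le_m1[of 2 "{{w, v}}" "{u, w}"] by simp
  moreover have "card {d \<in> ?F e. x \<in> d} \<le> card (?F e)" for e x by (intro card_mono) auto
  ultimately show "card {d \<in> ?F e. x \<in> d} \<le> 2" for e x using order_trans by blast
  show "card {d \<in> ?F e. id x \<in> d} \<le> 1" if "e \<in> E" "x \<in> e" for e x
  proof -
    have "x \<in> V" using sub(1)[OF that(1)] that(2) by blast
    then have xw: "x \<noteq> w" using w by auto
    have "{d \<in> ?F e. id x \<in> d} \<subseteq> {if e = {u, v} then {x, w} else e}"
      using xw that(2) by (auto simp: insert_commute split: if_splits)
    then have "card {d \<in> ?F e. id x \<in> d} \<le> card {if e = {u, v} then {x, w} else e}"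
      by (intro card_mono) auto
    then show ?thesis by simp
  qed
qed

section \<open>Models from topological minors\<close>

lemma simple_graph_pair_graph:
  assumes "pair_graph G"
  shows "simple_graph (pverts G) (edges G)"
proof -
  interpret pair_graph G by fact
  show ?thesis unfolding simple_graph_def edges_def
    using pair_finite_verts in_arcsD1 in_arcsD2 no_loops' by (auto simp: card_insert_if)
qed

lemma in_edges_iff:
  assumes "pair_graph G"
  shows "{u, v} \<in> edges G \<longleftrightarrow> (u, v) \<in> parcs G"
proof -
  interpret pair_graph G by fact
  have "(y, x) \<in> parcs G" if "(x, y) \<in> parcs G" for x y
    using pair_sym_arcs that by (auto simp: symmetric_def sym_def)
  then show ?thesis unfolding edges_def by (auto simp: image_iff doubleton_eq_iff)
qed

lemma edges_subdivide: "edges (subdivide G (u, v) w) = edges G - {{u, v}} \<union> {{u, w}, {w, v}}"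
proof -
  let ?pair = "\<lambda>(x, y). {x, y} :: 'a set"
  have "?pair ` (parcs G - {(u, v), (v, u)}) = ?pair ` parcs G - {{u, v}}"
  proof (intro equalityI subsetI)
    fix d assume "d \<in> ?pair ` (parcs G - {(u, v), (v, u)})"
    then obtain x y where "(x, y) \<in> parcs G" "(x, y) \<noteq> (u, v)" "(x, y) \<noteq> (v, u)" "d = {x, y}" by auto
    moreover from this have "{x, y} \<noteq> {u, v}" by (auto simp: doubleton_eq_iff)
    ultimately show "d \<in> ?pair ` parcs G - {{u, v}}" by (auto intro: image_eqI[of _ _ "(x, y)"])
  next
    fix d assume "d \<in> ?pair ` parcs G - {{u, v}}"
    then obtain x y where xy: "(x, y) \<in> parcs G" "d = {x, y}" "d \<noteq> {u, v}" by auto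
    then have "(x, y) \<in> parcs G - {(u, v), (v, u)}" by auto
    then show "d \<in> ?pair ` (parcs G - {(u, v), (v, u)})" using xy(2) by force
  qed
  moreover have "?pair ` {(u, w), (w, u), (w, v), (v, w)} = {{u, w}, {w, v}}" by (auto simp: insert_commute)
  ultimately show ?thesis unfolding edges_def arcs_subdivide image_Un by simp
qed

text \<open>
  A relation that contains \<open>topological_minor\<close> and whose transitivity is that of models, so that no steps of
  different subdivisions have to be exchanged.
\<close>

definition has_model :: "'a pair_pre_digraph \<Rightarrow> 'a pair_pre_digraph \<Rightarrow> bool" where
  "has_model H G \<longleftrightarrow> (\<exists>\<phi> F. topological_model (pverts H) (edges H) (pverts G) (edges G) \<phi> F)"

lemma has_model_trans: "has_model G H \<Longrightarrow> has_model H K \<Longrightarrow> has_model G K"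
  unfolding has_model_def by (elim exE, intro exI) (rule topological_model_trans)

lemma has_model_subgraph:
  assumes "is_subgraph H G"
  shows "has_model H G"
proof -
  have "pair_graph H" "pair_graph G" and sub: "pverts H \<subseteq> pverts G" "parcs H \<subseteq> parcs G"
    using assms by (auto simp: is_subgraph_def subgraph_def)
  moreover have "edges H \<subseteq> edges G" using sub by (auto simp: edges_def)
  ultimately have "topological_model (pverts H) (edges H) (pverts G) (edges G) id (\<lambda>e. {id ` e})"
    by (intro topological_model_embedding simple_graph_pair_graph) auto
  then show ?thesis unfolding has_model_def by blast
qed

lemma has_model_refl:
  assumes "pair_graph G"
  shows "has_model G G"
proof -
  note G = simple_graph_pair_graph[OF assms]
  have "topological_model (pverts G) (edges G) (pverts G) (edges G) id (\<lambda>e. {id ` e})"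
    by (rule topological_model_embedding[OF G G]) auto
  then show ?thesis unfolding has_model_def by blast
qed

text \<open>
  Both graphs have the projections as end maps, so the action of an isomorphism on arcs is determined by
  its action on vertices.
\<close>

lemma has_model_iso:
  assumes "digraph_iso (with_proj S) (with_proj S')" and S: "pair_graph S" and S': "pair_graph S'"
  shows "has_model S S'"
proof -
  obtain h where h: "pre_digraph.digraph_isomorphism (with_proj S) h"
    and eq: "with_proj S' = app_iso h (with_proj S)"
    using assms(1) by (auto simp: digraph_iso_def)
  let ?\<phi> = "iso_verts h"
  have verts: "pverts S' = ?\<phi> ` pverts S" and arcs: "parcs S' = iso_arcs h ` parcs S"
    and tl: "fst = iso_tail h" and hd: "snd = iso_head h"
    using arg_cong[OF eq, of verts] arg_cong[OF eq, of arcs] arg_cong[OF eq, of tail] arg_cong[OF eq, of head]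
    by simp_all
  have inj: "inj_on ?\<phi> (pverts S)"
    using pre_digraph.digraph_isomorphism_inj_on_verts[OF h] by simp
  have arc: "iso_arcs h (x, y) = (?\<phi> x, ?\<phi> y)" if "(x, y) \<in> parcs S" for x y
    using pre_digraph.iso_verts_tail[OF h, of "(x, y)"] pre_digraph.iso_verts_head[OF h, of "(x, y)"] that tl hd
    by (simp add: prod_eq_iff)
  have "?\<phi> ` e \<in> edges S'" if e: "e \<in> edges S" for e
  proof -
    obtain x y where xy: "e = {x, y}" "(x, y) \<in> parcs S" using e by (auto simp: edges_def)
    then have "(?\<phi> x, ?\<phi> y) \<in> parcs S'" using arc arcs by (metis imageI)
    then show ?thesis using xy in_edges_iff[OF S'] by simp
  qed
  then have "topological_model (pverts S) (edges S) (pverts S') (edges S') ?\<phi> (\<lambda>e. {?\<phi> ` e})"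
    by (intro topological_model_embedding[OF simple_graph_pair_graph[OF S] simple_graph_pair_graph[OF S'] inj])
      (auto simp: verts)
  then show ?thesis unfolding has_model_def by blast
qed

lemma has_model_subdivision:
  assumes "subdivision_pair H S" and H: "pair_graph H"
  shows "has_model H S"
  using assms(1)
proof (induct rule: subdivision_pair_induct)
  case base
  show ?case by (rule has_model_refl[OF H])
next
  case (divide e w K)
  obtain u v where e: "e = (u, v)" by (cases e)
  have K: "pair_graph K" using pair_graph.pair_graph_subdivision[OF H] divide by blast
  have "topological_model (pverts K) (edges K) (pverts (subdivide K e w)) (edges (subdivide K e w)) id
     (\<lambda>d. if d = {u, v} then {{u, w}, {w, v}} else {d})"
    using topological_model_subdivide[OF simple_graph_pair_graph[OF K], of u v w] divide(1,2)
    by (simp add: e in_edges_iff[OF K] edges_subdivide)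
  then have "has_model K (subdivide K e w)" unfolding has_model_def by blast
  then show ?case using divide has_model_trans by blast
qed

lemma has_model_topological_minor:
  assumes "topological_minor H G"
  shows "has_model H G"
proof -
  obtain S S' where H: "pair_graph H" and S: "subdivision_pair H S"
    and iso: "digraph_iso (with_proj S) (with_proj S')" and sub: "is_subgraph S' G"
    using assms unfolding topological_minor_def by blast
  have "pair_graph S" by (rule pair_graph.pair_graph_subdivision[OF H S])
  moreover have "pair_graph S'" using sub by (simp add: is_subgraph_def)
  ultimately have "has_model S S'" by (rule has_model_iso[OF iso])
  then show ?thesis
    using has_model_subdivision[OF S H] has_model_subgraph[OF sub] has_model_trans by blast
qed

section \<open>Drawing the routes of a model\<close>

text \<open>
  The subgraph of the target formed by the branch vertices and all routes; for a topological minor this is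
  the subdivision itself.
\<close>

definition route_graph :: "('v \<Rightarrow> 'w) \<Rightarrow> ('v set \<Rightarrow> 'w set set) \<Rightarrow> 'v set \<Rightarrow> 'v set set \<Rightarrow> 'w pair_pre_digraph" where
  "route_graph \<phi> F V E =
     \<lparr>pverts = \<phi> ` V \<union> \<Union>(\<Union>(F ` E)), parcs = {(x, y). {x, y} \<in> \<Union>(F ` E)}\<rparr>"

lemma drawingD:
  assumes "drawing G p \<gamma>"
  shows drawing_inj: "inj_on p (pverts G)"
    and drawing_arc: "e \<in> edges G \<Longrightarrow> arc (\<gamma> e)"
    and drawing_ends: "e \<in> edges G \<Longrightarrow> {pathstart (\<gamma> e), pathfinish (\<gamma> e)} = p ` e"
    and drawing_vertex: "e \<in> edges G \<Longrightarrow> v \<in> pverts G \<Longrightarrow> p v \<in> path_image (\<gamma> e) \<Longrightarrow> v \<in> e"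
    and drawing_triple: "e \<in> edges G \<Longrightarrow> f \<in> edges G \<Longrightarrow> g \<in> edges G \<Longrightarrow>
      e \<noteq> f \<Longrightarrow> e \<noteq> g \<Longrightarrow> f \<noteq> g \<Longrightarrow>
      path_image (\<gamma> e) \<inter> path_image (\<gamma> f) \<inter> path_image (\<gamma> g) \<subseteq> p ` (e \<inter> f \<inter> g)"
  using assms unfolding drawing_def by simp_all

context topological_model begin

lemma route_edgeE:
  assumes "d \<in> \<Union>(F ` E)"
  obtains x y where "d = {x, y}" "x \<noteq> y" "x \<in> V'" "y \<in> V'"
proof -
  have "d \<in> E'" using assms route by blast
  then have "card d = 2" "d \<subseteq> V'" using target by (auto simp: simple_graph_def)
  then obtain x y where "d = {x, y}" "x \<noteq> y" unfolding card_2_iff by blast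
  then show thesis using that \<open>d \<subseteq> V'\<close> by simp
qed

lemma edges_route_graph: "edges (route_graph \<phi> F V E) = \<Union>(F ` E)"
proof (intro equalityI subsetI)
  fix d assume "d \<in> edges (route_graph \<phi> F V E)"
  then show "d \<in> \<Union>(F ` E)" by (auto simp: edges_def route_graph_def)
next
  fix d assume d: "d \<in> \<Union>(F ` E)"
  then obtain x y where "d = {x, y}" by (rule route_edgeE)
  then show "d \<in> edges (route_graph \<phi> F V E)"
    using d unfolding edges_def route_graph_def by (intro image_eqI[of _ _ "(x, y)"]) auto
qed

lemma route_graph_verts: "pverts (route_graph \<phi> F V E) \<subseteq> V'"
proof -
  have "d \<subseteq> V'" if "d \<in> \<Union>(F ` E)" for d using route_edgeE[OF that] by blast
  then show ?thesis using branch_in unfolding route_graph_def by auto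
qed

lemma pair_graph_route_graph: "pair_graph (route_graph \<phi> F V E)"
proof -
  let ?G = "route_graph \<phi> F V E"
  have fin: "finite (pverts ?G)"
    using route_graph_verts target finite_subset by (auto simp: simple_graph_def)
  have in_verts: "x \<in> pverts ?G" "y \<in> pverts ?G" if "(x, y) \<in> parcs ?G" for x y
  proof -
    have "{x, y} \<in> \<Union>(F ` E)" using that by (simp add: route_graph_def)
    then show "x \<in> pverts ?G" "y \<in> pverts ?G"
      unfolding route_graph_def pair_pre_digraph.select_convs by blast+
  qed
  have "parcs ?G \<subseteq> pverts ?G \<times> pverts ?G" using in_verts by auto
  then have fina: "finite (parcs ?G)" using fin finite_subset by blast
  have loop: "x \<noteq> y" if "(x, y) \<in> parcs ?G" for x y
  proof
    assume "x = y"
    then have d: "{x} \<in> \<Union>(F ` E)" using that by (auto simp: route_graph_def)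
    obtain a b where "{x} = {a, b}" "a \<noteq> b" using d by (rule route_edgeE)
    then show False by auto
  qed
  have "symmetric (with_proj ?G)"
    by (auto simp: symmetric_def sym_def route_graph_def insert_commute)
  then show ?thesis
    using fin fina in_verts loop by unfold_locales auto
qed

text \<open>
  A vertex that is not a branch vertex lies in at most one route.
\<close>

lemma degree_route_graph:
  assumes "x \<notin> \<phi> ` V"
  shows "out_degree (with_proj (route_graph \<phi> F V E)) x \<le> 2"
proof -
  let ?G = "route_graph \<phi> F V E"
  have fin: "finite {d \<in> \<Union>(F ` E). x \<in> d}"
    using finite_route simple_graph_finite_edges[OF source] by auto
  have "out_degree (with_proj ?G) x \<le> card {d \<in> \<Union>(F ` E). x \<in> d}"
    unfolding out_degree_def
  proof (rule card_inj_on_le[OF _ _ fin])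
    show "inj_on (\<lambda>a. {fst a, snd a}) (out_arcs (with_proj ?G) x)"
      by (auto simp: inj_on_def out_arcs_def doubleton_eq_iff)
    show "(\<lambda>a. {fst a, snd a}) ` out_arcs (with_proj ?G) x \<subseteq> {d \<in> \<Union>(F ` E). x \<in> d}"
      by (auto simp: out_arcs_def route_graph_def)
  qed
  also have "\<dots> \<le> 2"
  proof (cases "\<exists>e\<in>E. x \<in> \<Union>(F e)")
    case True
    then obtain e where e: "e \<in> E" "x \<in> \<Union>(F e)" by blast
    have "f = e" if "f \<in> E" "x \<in> \<Union>(F f)" for f
      using meet[of e f] e that assms source by (auto simp: simple_graph_def)
    then have "{d \<in> \<Union>(F ` E). x \<in> d} \<subseteq> {d \<in> F e. x \<in> d}" by blast
    then have "card {d \<in> \<Union>(F ` E). x \<in> d} \<le> card {d \<in> F e. x \<in> d}"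
      using finite_route[OF e(1)] by (intro card_mono) auto
    then show ?thesis using degree_inner[OF e(1) assms] by linarith
  next
    case False
    then have empty: "{d \<in> \<Union>(F ` E). x \<in> d} = {}" by blast
    show ?thesis unfolding empty by simp
  qed
  finally show ?thesis .
qed

lemma num_verts_deg_ge3_route_graph: "num_verts (deg_ge3 (route_graph \<phi> F V E)) \<le> card V"
proof -
  have "pverts (deg_ge3 (route_graph \<phi> F V E)) \<subseteq> \<phi> ` V"
    using degree_route_graph unfolding deg_ge3_def by (force simp: Let_def)
  moreover have "finite V" using source by (simp add: simple_graph_def)
  ultimately show ?thesis
    unfolding num_verts_def by (meson card_image_le card_mono finite_imageI order_trans)
qed

text \<open>
  Blobs are the points of the branch vertices, and each edge is drawn as a path within the arcs of its route.
  If two independent edges meet in \<open>z\<close>, then \<open>z\<close> lies on two vertex-disjoint edges of the drawing and is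
  a crossing. As no three edges cross in one point, these two are the only edges through \<open>z\<close>, so
  \<open>z\<close> determines the two routes and the crossing pair.
\<close>

lemma blob_drawing_of_route_drawing:
  assumes draw: "drawing (route_graph \<phi> F V E) p \<gamma>" and fin: "finite (crossings (route_graph \<phi> F V E) p \<gamma>)"
  shows "\<exists>T A. blob_drawing V E T A \<and> card (crossing_pairs E A) \<le> card (crossings (route_graph \<phi> F V E) p \<gamma>)"
proof -
  let ?G = "route_graph \<phi> F V E"
  define U where "U e = (\<Union>d\<in>F e. path_image (\<gamma> d))" for e
  have p_inj: "inj_on p (pverts ?G)" by (rule drawing_inj[OF draw])
  have edge_arc: "arc (\<gamma> d)" "{pathstart (\<gamma> d), pathfinish (\<gamma> d)} = p ` d" if "e \<in> E" "d \<in> F e" for e d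
    using drawing_arc[OF draw] drawing_ends[OF draw] that unfolding edges_route_graph by blast+
  have on_edge: "w \<in> d" if "e \<in> E" "d \<in> F e" "w \<in> pverts ?G" "p w \<in> path_image (\<gamma> d)" for e d w
    using drawing_vertex[OF draw] that unfolding edges_route_graph by blast
  have triple: "d2 = d3 \<or> d1 = d3"
    if "d1 \<in> \<Union>(F ` E)" "d2 \<in> \<Union>(F ` E)" "d3 \<in> \<Union>(F ` E)" "d1 \<inter> d2 = {}" "d1 \<noteq> d2"
      "z \<in> path_image (\<gamma> d1)" "z \<in> path_image (\<gamma> d2)" "z \<in> path_image (\<gamma> d3)" for d1 d2 d3 z
  proof (rule ccontr)
    assume "\<not> (d2 = d3 \<or> d1 = d3)"
    then have "path_image (\<gamma> d1) \<inter> path_image (\<gamma> d2) \<inter> path_image (\<gamma> d3) \<subseteq> p ` (d1 \<inter> d2 \<inter> d3)"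
      using that(1-3,5) by (intro drawing_triple[OF draw]) (auto simp: edges_route_graph)
    then show False using that by auto
  qed
  have branch_vert: "\<phi> v \<in> pverts ?G" if "v \<in> V" for v using that by (simp add: route_graph_def)
  have route_step: "path_component (U e) (p x) (p y)" if "e \<in> E" "{x, y} \<in> F e" for e x y
  proof -
    have "path_image (\<gamma> {x, y}) \<subseteq> U e" using that unfolding U_def by blast
    moreover have "path_connected (path_image (\<gamma> {x, y}))"
      using edge_arc(1)[OF that] by (intro path_connected_path_image arc_imp_path)
    moreover have "p x \<in> path_image (\<gamma> {x, y})" "p y \<in> path_image (\<gamma> {x, y})"
      using edge_arc(2)[OF that] pathstart_in_path_image[of "\<gamma> {x, y}"] pathfinish_in_path_image[of "\<gamma> {x, y}"]
      by (auto simp: doubleton_eq_iff)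
    ultimately show ?thesis unfolding path_connected_component by (meson path_component_of_subset)
  qed
  have "\<exists>B. path_connected B \<and> B \<subseteq> U e \<and> (\<forall>v\<in>e. p (\<phi> v) \<in> B)" if e: "e \<in> E" for e
  proof -
    have "card e = 2" using source e by (simp add: simple_graph_def)
    then obtain u v where uv: "e = {u, v}" "u \<noteq> v" unfolding card_2_iff by blast
    have E_uv: "{u, v} \<in> E" using e uv by simp
    have neq: "\<phi> u \<noteq> \<phi> v" using inj simple_graph_edgeD[OF source E_uv] by (auto dest: inj_onD)
    have con: "(\<phi> u, \<phi> v) \<in> {(x, y). {x, y} \<in> F e}\<^sup>*" using connects[OF E_uv] uv by simp
    then obtain y where "{\<phi> u, y} \<in> F e" using neq by (auto elim: converse_rtranclE)
    then have base: "p (\<phi> u) \<in> U e" using route_step[OF e] path_component_mem by blast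
    from con have "path_component (U e) (p (\<phi> u)) (p (\<phi> v))"
    proof (induction rule: rtrancl_induct)
      case base
      then show ?case using \<open>p (\<phi> u) \<in> U e\<close> by (rule path_component_refl)
    next
      case (step y z)
      then show ?case using route_step[OF e, of y z] by (auto intro: path_component_trans)
    qed
    then obtain g where g: "path g" "path_image g \<subseteq> U e" "pathstart g = p (\<phi> u)" "pathfinish g = p (\<phi> v)"
      unfolding path_component_def by blast
    then have "p (\<phi> u) \<in> path_image g" "p (\<phi> v) \<in> path_image g"
      using pathstart_in_path_image[of g] pathfinish_in_path_image[of g] by auto
    then show ?thesis using g uv by (intro exI[of _ "path_image g"]) (auto intro: path_connected_path_image)
  qed
  then obtain A where A: "\<And>e. e \<in> E \<Longrightarrow> path_connected (A e)" "\<And>e. e \<in> E \<Longrightarrow> A e \<subseteq> U e"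
    "\<And>e v. e \<in> E \<Longrightarrow> v \<in> e \<Longrightarrow> p (\<phi> v) \<in> A e"
    by metis
  define T where "T v = {p (\<phi> v)}" for v
  have "blob_drawing V E T A"
    unfolding blob_drawing_def
  proof (intro conjI ballI impI)
    fix u v assume "u \<in> V" "v \<in> V" "u \<noteq> v"
    then have "p (\<phi> u) \<noteq> p (\<phi> v)" using branch_vert by (simp add: inj_on_eq_iff[OF p_inj] inj_on_eq_iff[OF inj])
    then show "T u \<inter> T v = {}" by (simp add: T_def)
  next
    fix e v assume e: "e \<in> E" and v: "v \<in> V - e"
    have "p (\<phi> v) \<notin> A e"
    proof
      assume "p (\<phi> v) \<in> A e"
      then obtain d where d: "d \<in> F e" "p (\<phi> v) \<in> path_image (\<gamma> d)" using A(2)[OF e] unfolding U_def by blast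
      then have "\<phi> v \<in> d" using on_edge[OF e d(1)] branch_vert v by blast
      then show False using avoids[OF e, of v] d v by blast
    qed
    then show "A e \<inter> T v = {}" by (simp add: T_def)
  qed (use A in \<open>auto simp: T_def\<close>)
  moreover have "card (crossing_pairs E A) \<le> card (crossings ?G p \<gamma>)"
  proof -
    have crossing_point: "\<exists>z. z \<in> crossings ?G p \<gamma> \<and> P = {e \<in> E. z \<in> U e}" if P: "P \<in> crossing_pairs E A" for P
    proof -
      from P obtain e f where P_eq: "P = {e, f}" and e: "e \<in> E" and f: "f \<in> E" and ef: "e \<inter> f = {}" "A e \<inter> A f \<noteq> {}"
        by (rule crossing_pairsE)
      have "e \<noteq> {}" using source e by (auto simp: simple_graph_def)
      then have neq: "e \<noteq> f" using ef by blast
      obtain z where "z \<in> U e" "z \<in> U f" using ef A(2) e f by blast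
      then obtain d1 d2 where d1: "d1 \<in> F e" "z \<in> path_image (\<gamma> d1)" and d2: "d2 \<in> F f" "z \<in> path_image (\<gamma> d2)"
        unfolding U_def by blast
      have disj: "d1 \<inter> d2 = {}" using meet[OF e f neq] ef d1 d2 by blast
      have d_neq: "d1 \<noteq> d2" using routes_disjoint[OF e f neq] d1 d2 by blast
      have in_U: "d1 \<in> \<Union>(F ` E)" "d2 \<in> \<Union>(F ` E)" using d1 d2 e f by blast+
      have "z \<in> crossings ?G p \<gamma>"
        unfolding crossings_def edges_route_graph using in_U d1 d2 d_neq disj by blast
      moreover have "P = {e \<in> E. z \<in> U e}"
      proof (intro equalityI subsetI)
        fix g assume "g \<in> P"
        then show "g \<in> {e \<in> E. z \<in> U e}" using P_eq e f \<open>z \<in> U e\<close> \<open>z \<in> U f\<close> by blast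
      next
        fix g assume "g \<in> {e \<in> E. z \<in> U e}"
        then obtain d3 where g: "g \<in> E" "d3 \<in> F g" "z \<in> path_image (\<gamma> d3)" unfolding U_def by blast
        then have "d2 = d3 \<or> d1 = d3" using triple[OF in_U _ disj d_neq d1(2) d2(2)] by blast
        then show "g \<in> P" using routes_disjoint[OF e g(1)] routes_disjoint[OF f g(1)] d1 d2 g P_eq by blast
      qed
      ultimately show ?thesis by blast
    qed
    then obtain pt where pt: "\<And>P. P \<in> crossing_pairs E A \<Longrightarrow> pt P \<in> crossings ?G p \<gamma>"
      "\<And>P. P \<in> crossing_pairs E A \<Longrightarrow> P = {e \<in> E. pt P \<in> U e}" by metis
    show ?thesis
    proof (rule card_inj_on_le[OF _ _ fin])
      show "inj_on pt (crossing_pairs E A)" by (rule inj_onI) (metis pt(2))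
      show "pt ` crossing_pairs E A \<subseteq> crossings ?G p \<gamma>" using pt(1) by blast
    qed
  qed
  ultimately show ?thesis by blast
qed

end

section \<open>Density of the crossing class\<close>

lemma (in topological_model) is_subgraph_route_graph:
  assumes G: "pair_graph G" and V': "V' = pverts G" and E': "E' = edges G"
  shows "is_subgraph (route_graph \<phi> F V E) G"
proof -
  let ?R = "route_graph \<phi> F V E"
  have R: "pair_graph ?R" by (rule pair_graph_route_graph)
  have wf: "wf_digraph (with_proj K)" if "pair_graph K" for K :: "'b pair_pre_digraph"
    using that by (simp add: wf_digraph_wp_iff pair_graph_def pair_digraph_def pair_fin_digraph_def)
  have "parcs ?R \<subseteq> parcs G"
  proof
    fix a assume "a \<in> parcs ?R"
    then obtain x y where a: "a = (x, y)" "{x, y} \<in> \<Union>(F ` E)" by (auto simp: route_graph_def)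
    then have "{x, y} \<in> edges G" using route E' by blast
    then show "a \<in> parcs G" using a in_edges_iff[OF G] by simp
  qed
  then show ?thesis
    unfolding is_subgraph_def subgraph_def
    using route_graph_verts V' R G wf[OF R] wf[OF G] by (simp add: compatibleI_with_proj)
qed

text \<open>
  An infimum over no drawings would be infinite, so a finite bound yields a drawing that attains it.
\<close>

lemma crossing_number_attained:
  assumes "ereal_of_enat (crossing_number H) \<le> ereal r"
  shows "\<exists>p \<gamma>. drawing H p \<gamma> \<and> finite (crossings H p \<gamma>) \<and> real (card (crossings H p \<gamma>)) \<le> r"
proof -
  let ?S = "{enat (card (crossings H p \<gamma>)) | p \<gamma>. drawing H p \<gamma> \<and> finite (crossings H p \<gamma>)}"
  have "?S \<noteq> {}"
  proof
    assume empty: "?S = {}"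
    have "crossing_number H = \<infinity>" unfolding crossing_number_def empty by (simp add: top_enat_def)
    then show False using assms by simp
  qed
  then obtain k where k: "k \<in> ?S" by blast
  have "crossing_number H \<in> ?S" unfolding crossing_number_def by (rule wellorder_InfI[OF k])
  then obtain p \<gamma> where *: "crossing_number H = enat (card (crossings H p \<gamma>))"
    "drawing H p \<gamma>" "finite (crossings H p \<gamma>)" by (elim CollectE exE conjE)
  have "real (card (crossings H p \<gamma>)) \<le> r" using assms unfolding *(1) by simp
  then show ?thesis using * by blast
qed

text \<open>
  If the density exceeded the bound, its cube would exceed \<open>64 * c\<close>. The crossing lemma bounds this cube by
  \<open>64\<close> times the number of crossings per vertex of \<open>V\<close>, and membership in the class provides a drawing of the
  route graph in which this number is at most \<open>c\<close>.
\<close>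

theorem density_of_model:
  assumes c: "c \<ge> 1" and G: "G \<in> crossing_class c"
    and model: "topological_model V E (pverts G) (edges G) \<phi> F"
  shows "real (card E) \<le> 4 * c powr (1 / 3) * real (card V)"
proof (rule ccontr)
  assume contra: "\<not> ?thesis"
  interpret topological_model V E "pverts G" "edges G" \<phi> F by fact
  let ?R = "route_graph \<phi> F V E"
  define n m where "n = real (card V)" and "m = real (card E)"
  have n0: "n \<ge> 0" by (simp add: n_def)
  have pg: "pair_graph G" using G by (simp add: crossing_class_def)
  have "ereal_of_enat (crossing_number ?R) \<le> ereal (c * real (num_verts (deg_ge3 ?R)))"
    using G is_subgraph_route_graph[OF pg refl refl] by (simp add: crossing_class_def)
  then obtain p \<gamma> where draw: "drawing ?R p \<gamma>" and fin: "finite (crossings ?R p \<gamma>)"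
    and few: "real (card (crossings ?R p \<gamma>)) \<le> c * real (num_verts (deg_ge3 ?R))"
    using crossing_number_attained by blast
  have few': "real (card (crossings ?R p \<gamma>)) \<le> c * n"
  proof -
    have "c * real (num_verts (deg_ge3 ?R)) \<le> c * n"
      unfolding n_def using num_verts_deg_ge3_route_graph c by (intro mult_left_mono) auto
    then show ?thesis using few by linarith
  qed
  obtain T A where blob: "blob_drawing V E T A"
    and k: "card (crossing_pairs E A) \<le> card (crossings ?R p \<gamma>)"
    using blob_drawing_of_route_drawing[OF draw fin] by blast
  have root: "1 \<le> c powr (1 / 3)" using c by (simp add: ge_one_powr_ge_zero)
  have dense: "4 * c powr (1 / 3) * n < m" using contra by (simp add: n_def m_def)
  have "4 * n \<le> 4 * c powr (1 / 3) * n" using root n0 by (intro mult_right_mono) auto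
  then have "4 * card V \<le> card E" using dense unfolding n_def m_def by linarith
  then have "m ^ 3 \<le> 64 * n ^ 2 * real (card (crossing_pairs E A))"
    unfolding n_def m_def by (rule crossing_lemma[OF source blob])
  also have "\<dots> \<le> 64 * n ^ 2 * (c * n)"
    using k few' by (intro mult_left_mono) auto
  also have "\<dots> = (4 * c powr (1 / 3) * n) ^ 3"
  proof -
    have "(c powr (1 / 3)) ^ 3 = c" using c by (simp add: powr_power)
    then show ?thesis by (simp add: power_mult_distrib power2_eq_square power3_eq_cube)
  qed
  finally have "m ^ 3 \<le> (4 * c powr (1 / 3) * n) ^ 3" .
  moreover have "(4 * c powr (1 / 3) * n) ^ 3 < m ^ 3"
    using dense n0 by (intro power_strict_mono) auto
  ultimately show False by simp
qed

corollary density_of_has_model: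
  assumes "c \<ge> 1" "G \<in> crossing_class c" "has_model H G"
  shows "real (num_edges H) \<le> 4 * c powr (1 / 3) * real (num_verts H)"
  using assms density_of_model unfolding has_model_def num_edges_def num_verts_def by blast

text \<open>
  A complete graph on sufficiently many vertices.
\<close>

lemma exists_dense_graph:
  "\<exists>K :: 'a::infinite pair_pre_digraph. pair_graph K \<and> r * real (num_verts K) < real (num_edges K)"
proof -
  define N :: nat where "N = nat \<lceil>2 * \<bar>r\<bar>\<rceil> + 2"
  have N: "2 * r < real N - 1" "0 < N" unfolding N_def by linarith+
  obtain W :: "'a set" where W: "finite W" "card W = N"
    using infinite_arbitrarily_large[OF infinite_UNIV, of N] by blast
  let ?K = "\<lparr>pverts = W, parcs = {(x, y). x \<in> W \<and> y \<in> W \<and> x \<noteq> y}\<rparr>"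
  have fin: "finite {(x, y). x \<in> W \<and> y \<in> W \<and> x \<noteq> y}"
    by (rule finite_subset[of _ "W \<times> W"]) (use W in auto)
  have "symmetric (with_proj ?K)" by (auto simp: symmetric_def sym_def)
  then have "pair_graph ?K" using W fin by unfold_locales auto
  moreover have "edges ?K = {e. e \<subseteq> W \<and> card e = 2}"
  proof (intro equalityI subsetI)
    fix e assume "e \<in> edges ?K"
    then show "e \<in> {e. e \<subseteq> W \<and> card e = 2}" by (auto simp: edges_def)
  next
    fix e assume "e \<in> {e. e \<subseteq> W \<and> card e = 2}"
    then obtain x y where "e = {x, y}" "x \<noteq> y" "x \<in> W" "y \<in> W" by (auto simp: card_2_iff)
    then show "e \<in> edges ?K" unfolding edges_def by (intro image_eqI[of _ _ "(x, y)"]) auto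
  qed
  then have edges: "real (num_edges ?K) = real N * (real N - 1) / 2"
    using W N(2) by (simp add: num_edges_def n_subsets choose_two real_of_nat_div of_nat_diff)
  have "r * real N < real N * (real N - 1) / 2"
  proof -
    have "real N * (2 * r) < real N * (real N - 1)" using N by (intro mult_strict_left_mono) auto
    then show ?thesis by (simp add: algebra_simps)
  qed
  then have "r * real (num_verts ?K) < real (num_edges ?K)" using edges W by (simp add: num_verts_def)
  ultimately show ?thesis by blast
qed

theorem theorem5p2:
  fixes c :: real
  assumes "c \<ge> 1"
  shows "(\<exists>\<D> :: 'a::infinite pair_pre_digraph set.
            topologically_closed \<D> \<and> proper_class \<D> \<and> crossing_class c \<subseteq> \<D>)
         \<and> nabla_top (crossing_class c :: 'a pair_pre_digraph set) \<le> ereal (4 * c powr (1 / 3))"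
proof
  let ?D = "{H :: 'a pair_pre_digraph. pair_graph H \<and> (\<exists>G\<in>crossing_class c. has_model H G)}"
  have "topologically_closed ?D"
    unfolding topologically_closed_def
  proof (intro conjI ballI allI impI)
    fix H K assume H: "H \<in> ?D" and K: "topological_minor K H"
    then obtain G where G: "G \<in> crossing_class c" "has_model H G" by blast
    have "has_model K G" by (rule has_model_trans[OF has_model_topological_minor[OF K] G(2)])
    moreover have "pair_graph K" using K by (simp add: topological_minor_def)
    ultimately show "K \<in> ?D" using G(1) by blast
  qed simp
  moreover have "proper_class ?D"
  proof -
    obtain K :: "'a pair_pre_digraph" where K: "pair_graph K"
      "4 * c powr (1 / 3) * real (num_verts K) < real (num_edges K)"
      using exists_dense_graph by blast
    have "K \<notin> ?D" using density_of_has_model[OF assms] K(2) by force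
    then show ?thesis using K(1) by (auto simp: proper_class_def)
  qed
  moreover have "crossing_class c \<subseteq> ?D"
    using has_model_refl by (auto simp: crossing_class_def)
  ultimately show "\<exists>\<D> :: 'a pair_pre_digraph set.
      topologically_closed \<D> \<and> proper_class \<D> \<and> crossing_class c \<subseteq> \<D>" by blast
  show "nabla_top (crossing_class c :: 'a pair_pre_digraph set) \<le> ereal (4 * c powr (1 / 3))"
    unfolding nabla_top_def
  proof (rule SUP_least)
    fix H :: "'a pair_pre_digraph"
    assume "H \<in> {H. pverts H \<noteq> {} \<and> (\<exists>G\<in>crossing_class c. topological_minor H G)}"
    then obtain G where H: "pverts H \<noteq> {}" and G: "G \<in> crossing_class c" "topological_minor H G" by blast
    have "pair_graph H" using G(2) by (simp add: topological_minor_def)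
    then have "finite (pverts H)" using simple_graph_pair_graph by (auto simp: simple_graph_def)
    then have "real (num_verts H) > 0" using H by (simp add: num_verts_def card_gt_0_iff)
    then show "ereal (real (num_edges H) / real (num_verts H)) \<le> ereal (4 * c powr (1 / 3))"
      using density_of_has_model[OF assms G(1) has_model_topological_minor[OF G(2)]]
      by (simp add: pos_divide_le_eq)
  qed
qed

end
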